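(* Let $\beta\in\mathbb{R}$ and $\eta>0$, and let $$\mathcal{V}(\theta;\eta,\beta)=-\sqrt{\eta}\,D_{-\theta}(-\beta)\,D_{-\theta/\eta}'\!\left(\tfrac{\beta}{\sqrt{\eta}}\right)-D_{-\theta}'(-\beta)\,D_{-\theta/\eta}\!\left(\tfrac{\beta}{\sqrt{\eta}}\right).$$ The spectral gap $r(\beta,\eta)$ of the diffusion process $(X(t))_{t\ge 0}$ is given by $r(\beta,\eta)=-\hat\theta$, where $\hat\theta$ is the least negative solution (i.e. the largest strictly negative root) $\theta$ of $\mathcal{V}(\theta;\eta,\beta)=0$. If $\beta=0$, solving $\mathcal{V}(\theta;\eta,0)=0$ is equivalent to finding the roots $\theta$ of $$\frac{\sqrt{\eta}}{\Gamma\left(\frac{\theta}{2\eta}\right)\Gamma\left(\frac{1+\theta}{2}\right)}+\frac{1}{\Gamma\left(\frac{\theta}{2}\right)\Gamma\left(\frac12+\frac{\theta}{2\eta}\right)}=0 .$$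
   Context: For $\beta\in\mathbb{R}$, $\eta>0$, $(X(t))_{t\ge0}$ is the Markov diffusion process on $\mathbb{R}$ whose transition density $p=p(x,t;x_0;\beta,\eta)$ satisfies $\partial_t p=-\partial_x[a(x)p]+\partial_x^2p$, with $a(x)=-\beta-\eta x$ for $x\ge0$ and $a(x)=-\beta-x$ for $x\le 0$, initial condition $p(x,0)=\delta(x-x_0)$, continuity of $p$ and $\partial_xp$ at $x=0$, and decay as $x\to\pm\infty$. Spectral gap: setting $p=e^{-\lambda t}\phi(x)$ and $\phi(x)=e^{-\beta x/2}e^{-x^2/4}\psi(x)$ for $x<0$, $\phi(x)=e^{-\beta x/2}e^{-\eta x^2/4}\psi(x)$ for $x>0$, yields the self-adjoint problem $-\psi''+V\psi=(\lambda+\tfrac12)\psi$ on $\mathbb{R}$, with $\psi\in L^2(\mathbb{R})$, $\psi$ and $\psi'$ continuous at $0$, $V(x)=\frac14(\beta+x)^2$ for $x<0$ and $V(x)=\frac14(\beta+\eta x)^2+\frac{1-\eta}{2}$ for $x>0$. Its spectrum is purely discrete, real and simple, $0=\lambda_0<\lambda_1<\lambda_2<\cdots$, and the spectral gap is $r(\beta,\eta)=\lambda_1$ (equivalently, $-r$ is the singularity closest to the imaginary axis, in $\mathrm{Re}(\theta)<0$, of the Laplace transform $\int_0^\infty e^{-\theta t}p(x,t)\,dt$). $D_\nu(z)$ is the parabolic cylinder function: the solution of $y''+(\nu+\frac12-\frac{z^2}{4})y=0$ given by $D_\nu(z)=\frac{1}{i\sqrt{2\pi}}e^{z^2/4}\int_{\mathrm{Br}}u^\nu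 e^{-zu}e^{u^2/2}du$, where $\mathrm{Br}$ is an upward vertical line with $\mathrm{Re}(u)>0$ and $u^\nu$ is the principal branch; it is entire in both $\nu$ and $z$, and $D_\nu(z)\sim z^\nu e^{-z^2/4}$ as $z\to+\infty$. $D_\nu'(z)=\frac{d}{dz}D_\nu(z)$. The function $1/\Gamma$ is the entire reciprocal Gamma function. *)

theory Defs
  imports "HOL-Analysis.Analysis"
begin

(* The integral of f along the upward vertical line Re u = c. *)
definition vertical_line_integral :: "real \<Rightarrow> (complex \<Rightarrow> complex) \<Rightarrow> complex" where
  "vertical_line_integral c f = (LINT t|lborel. \<i> * f (Complex c t))"

(* For c > 0 the integral does not depend on c (Cauchy's theorem); we integrate along Re u = 1. *)
definition parabolic_cylinder_D :: "complex \<Rightarrow> complex \<Rightarrow> complex" where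
  "parabolic_cylinder_D \<nu> z =
     1 / (\<i> * of_real (sqrt (2 * pi))) * exp (z\<^sup>2 / 4) *
     vertical_line_integral 1 (\<lambda>u. u powr \<nu> * exp (- z * u) * exp (u\<^sup>2 / 2))"

abbreviation parabolic_cylinder_D' :: "complex \<Rightarrow> complex \<Rightarrow> complex" where
  "parabolic_cylinder_D' \<nu> z \<equiv> deriv (parabolic_cylinder_D \<nu>) z"

definition char_fun :: "complex \<Rightarrow> real \<Rightarrow> real \<Rightarrow> complex" where
  "char_fun \<theta> \<eta> \<beta> =
     - of_real (sqrt \<eta>) * parabolic_cylinder_D (- \<theta>) (- of_real \<beta>)
         * parabolic_cylinder_D' (- \<theta> / of_real \<eta>) (of_real (\<beta> / sqrt \<eta>))
     - parabolic_cylinder_D' (- \<theta>) (- of_real \<beta>)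
         * parabolic_cylinder_D (- \<theta> / of_real \<eta>) (of_real (\<beta> / sqrt \<eta>))"

definition drift :: "real \<Rightarrow> real \<Rightarrow> real \<Rightarrow> real" where
  "drift \<beta> \<eta> x = (if x \<ge> 0 then - \<beta> - \<eta> * x else - \<beta> - x)"

definition gauge_factor :: "real \<Rightarrow> real \<Rightarrow> real \<Rightarrow> real" where
  "gauge_factor \<beta> \<eta> x =
     (if x < 0 then exp (- \<beta> * x / 2) * exp (- x\<^sup>2 / 4)
      else exp (- \<beta> * x / 2) * exp (- \<eta> * x\<^sup>2 / 4))"

(* The value at x = 0 is immaterial: the eigenvalue equation is imposed only for x \<noteq> 0. *)
definition potential :: "real \<Rightarrow> real \<Rightarrow> real \<Rightarrow> real" where
  "potential \<beta> \<eta> x =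
     (if x < 0 then (\<beta> + x)\<^sup>2 / 4 else (\<beta> + \<eta> * x)\<^sup>2 / 4 + (1 - \<eta>) / 2)"

(* Differentiability of psi at 0 together with continuity of psi' at 0 is the matching condition
   at the interface. *)
definition is_eigenfunction :: "real \<Rightarrow> real \<Rightarrow> real \<Rightarrow> (real \<Rightarrow> complex) \<Rightarrow> bool" where
  "is_eigenfunction \<beta> \<eta> \<mu> \<psi> \<longleftrightarrow>
     \<psi> \<noteq> (\<lambda>_. 0) \<and>
     integrable lborel (\<lambda>x. (norm (\<psi> x))\<^sup>2) \<and>
     (\<exists>\<psi>' \<psi>''.
        (\<forall>x. (\<psi> has_vector_derivative \<psi>' x) (at x)) \<and>
        isCont \<psi>' 0 \<and>
        (\<forall>x. x \<noteq> 0 \<longrightarrow>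
           (\<psi>' has_vector_derivative \<psi>'' x) (at x) \<and>
           - \<psi>'' x + of_real (potential \<beta> \<eta> x) * \<psi> x = of_real (\<mu> + 1 / 2) * \<psi> x))"

(* The problem is self-adjoint with purely discrete spectrum, so its spectrum is real and
   consists of the eigenvalues. *)
definition spectrum :: "real \<Rightarrow> real \<Rightarrow> real set" where
  "spectrum \<beta> \<eta> = {\<mu>. \<exists>\<psi>. is_eigenfunction \<beta> \<eta> \<mu> \<psi>}"

(* The first eigenvalue above the bottom eigenvalue 0 of the spectrum, as a relation: it holds
   for at most one r, and only if the infimum of the positive eigenvalues is attained. *)
definition is_spectral_gap :: "real \<Rightarrow> real \<Rightarrow> real \<Rightarrow> bool" where
  "is_spectral_gap \<beta> \<eta> r \<longleftrightarrow>
     r > 0 \<and> r \<in> spectrum \<beta> \<eta> \<and> (\<forall>\<mu>\<in>spectrum \<beta> \<eta>. \<mu> > 0 \<longrightarrow> r \<le> \<mu>)"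

lemma separated_solution_aux:
  fixes \<psi> \<psi>' \<psi>'' :: "real \<Rightarrow> complex"
    and S :: "real set" and w a :: "real \<Rightarrow> real" and \<beta> \<mu> s :: real
  assumes S: "open S" "x \<in> S"
    and d1: "\<And>y. y \<in> S \<Longrightarrow> (\<psi> has_vector_derivative \<psi>' y) (at y)"
    and d2: "\<And>y. y \<in> S \<Longrightarrow> (\<psi>' has_vector_derivative \<psi>'' y) (at y)"
    and w: "\<And>y. y \<in> S \<Longrightarrow> w y = exp (- \<beta> * y / 2 - s * y\<^sup>2 / 4)"
    and a: "\<And>y. y \<in> S \<Longrightarrow> a y = - \<beta> - s * y"
  defines "p \<equiv> (\<lambda>y t. (exp (- \<mu> * t) * w y) *\<^sub>R \<psi> y)"
  shows "vector_derivative (\<lambda>u. p x u) (at t) =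
           - vector_derivative (\<lambda>y. a y *\<^sub>R p y t) (at x)
           + vector_derivative (\<lambda>y. vector_derivative (\<lambda>z. p z t) (at y)) (at x)
         \<longleftrightarrow> - \<psi>'' x + of_real ((\<beta> + s * x)\<^sup>2 / 4 + (1 - s) / 2) * \<psi> x
               = of_real (\<mu> + 1 / 2) * \<psi> x"
proof -
  define g where "g y = exp (- \<beta> * y / 2 - s * y\<^sup>2 / 4)" for y
  define q where "q y = \<beta> + s * y" for y
  define e where "e = exp (- \<mu> * t)"
  have e: "e \<noteq> 0" and g0: "g x \<noteq> 0" by (auto simp: e_def g_def)
  have gd: "(g has_vector_derivative (- q y / 2 * g y)) (at y)" for y
    unfolding g_def q_def has_real_derivative_iff_has_vector_derivative [symmetric]
    by (auto intro!: derivative_eq_intros simp: power2_eq_square field_simps)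
  have qd: "(q has_vector_derivative s) (at y)" for y
    unfolding q_def has_real_derivative_iff_has_vector_derivative [symmetric]
    by (auto intro!: derivative_eq_intros)
  note vd = has_vector_derivative_scaleR
    [unfolded has_real_derivative_iff_has_vector_derivative]
  have P1: "((\<lambda>z. p z t) has_vector_derivative
               (e * g y) *\<^sub>R (\<psi>' y - (q y / 2) *\<^sub>R \<psi> y)) (at y)" if "y \<in> S" for y
  proof (rule has_vector_derivative_transform_within_open [OF _ S(1) that])
    show "((\<lambda>z. e *\<^sub>R (g z *\<^sub>R \<psi> z)) has_vector_derivative
               (e * g y) *\<^sub>R (\<psi>' y - (q y / 2) *\<^sub>R \<psi> y)) (at y)"
      by (rule has_vector_derivative_eq_rhs,
          rule bounded_linear.has_vector_derivative [OF bounded_linear_scaleR_right],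
          rule vd [OF gd d1 [OF that]])
         (simp add: scaleR_conv_of_real algebra_simps)
  qed (use w in \<open>auto simp: p_def e_def g_def\<close>)
  have P2: "((\<lambda>y. vector_derivative (\<lambda>z. p z t) (at y)) has_vector_derivative
      (e * g x) *\<^sub>R (\<psi>'' x - q x *\<^sub>R \<psi>' x + ((q x)\<^sup>2 / 4 - s / 2) *\<^sub>R \<psi> x)) (at x)"
  proof (rule has_vector_derivative_transform_within_open [OF _ S])
    show "((\<lambda>y. e *\<^sub>R (g y *\<^sub>R (\<psi>' y - (1 / 2) *\<^sub>R (q y *\<^sub>R \<psi> y)))) has_vector_derivative
      (e * g x) *\<^sub>R (\<psi>'' x - q x *\<^sub>R \<psi>' x + ((q x)\<^sup>2 / 4 - s / 2) *\<^sub>R \<psi> x)) (at x)"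
      by (rule has_vector_derivative_eq_rhs,
          rule bounded_linear.has_vector_derivative [OF bounded_linear_scaleR_right],
          rule vd [OF gd], rule has_vector_derivative_diff [OF d2 [OF S(2)]],
          rule bounded_linear.has_vector_derivative [OF bounded_linear_scaleR_right],
          rule vd [OF qd d1 [OF S(2)]])
         (simp add: scaleR_conv_of_real field_simps power2_eq_square)
  qed (use P1 [THEN vector_derivative_at] in auto)
  have P3: "((\<lambda>y. a y *\<^sub>R p y t) has_vector_derivative
      - ((e * g x) *\<^sub>R (s *\<^sub>R \<psi> x + q x *\<^sub>R \<psi>' x - ((q x)\<^sup>2 / 2) *\<^sub>R \<psi> x))) (at x)"
  proof (rule has_vector_derivative_transform_within_open [OF _ S])
    show "((\<lambda>y. (- e) *\<^sub>R (q y *\<^sub>R (g y *\<^sub>R \<psi> y))) has_vector_derivative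
      - ((e * g x) *\<^sub>R (s *\<^sub>R \<psi> x + q x *\<^sub>R \<psi>' x - ((q x)\<^sup>2 / 2) *\<^sub>R \<psi> x))) (at x)"
      by (rule has_vector_derivative_eq_rhs,
          rule bounded_linear.has_vector_derivative [OF bounded_linear_scaleR_right],
          rule vd [OF qd vd [OF gd d1 [OF S(2)]]])
         (simp add: scaleR_conv_of_real field_simps power2_eq_square)
  next
    fix y assume "y \<in> S"
    then have "w y = g y" "a y = - q y" using w a by (auto simp: g_def q_def)
    then show "(- e) *\<^sub>R (q y *\<^sub>R (g y *\<^sub>R \<psi> y)) = a y *\<^sub>R p y t"
      by (simp add: p_def e_def)
  qed
  have ed: "((\<lambda>u. exp (- \<mu> * u)) has_vector_derivative (- \<mu> * e)) (at t)"
    unfolding e_def has_real_derivative_iff_has_vector_derivative [symmetric]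
    by (auto intro!: derivative_eq_intros)
  have "w x = g x" using w S(2) by (simp add: g_def)
  then have P4: "((\<lambda>u. p x u) has_vector_derivative (e * g x) *\<^sub>R ((- \<mu>) *\<^sub>R \<psi> x)) (at t)"
    using bounded_linear.has_vector_derivative
        [OF bounded_linear_scaleR_left ed, of "g x *\<^sub>R \<psi> x"]
    by (simp add: p_def mult.commute mult.left_commute)
  have rhs: "- (- ((e * g x) *\<^sub>R (s *\<^sub>R \<psi> x + q x *\<^sub>R \<psi>' x - ((q x)\<^sup>2 / 2) *\<^sub>R \<psi> x)))
        + (e * g x) *\<^sub>R (\<psi>'' x - q x *\<^sub>R \<psi>' x + ((q x)\<^sup>2 / 4 - s / 2) *\<^sub>R \<psi> x)
      = (e * g x) *\<^sub>R (\<psi>'' x + (s / 2 - (q x)\<^sup>2 / 4) *\<^sub>R \<psi> x)"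
    by (simp add: scaleR_conv_of_real field_simps)
  have "vector_derivative (\<lambda>u. p x u) (at t) =
           - vector_derivative (\<lambda>y. a y *\<^sub>R p y t) (at x)
           + vector_derivative (\<lambda>y. vector_derivative (\<lambda>z. p z t) (at y)) (at x)
        \<longleftrightarrow> (e * g x) *\<^sub>R ((- \<mu>) *\<^sub>R \<psi> x) =
            (e * g x) *\<^sub>R (\<psi>'' x + (s / 2 - (q x)\<^sup>2 / 4) *\<^sub>R \<psi> x)"
    unfolding P2 [THEN vector_derivative_at] P3 [THEN vector_derivative_at]
      P4 [THEN vector_derivative_at]
    by (simp only: rhs)
  also have "\<dots> \<longleftrightarrow> (- \<mu>) *\<^sub>R \<psi> x = \<psi>'' x + (s / 2 - (q x)\<^sup>2 / 4) *\<^sub>R \<psi> x"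
    using e g0 by (simp only: scaleR_cancel_left mult_eq_0_iff simp_thms)
  also have "\<dots> \<longleftrightarrow> - \<psi>'' x + of_real ((q x)\<^sup>2 / 4 + (1 - s) / 2) * \<psi> x
               = of_real (\<mu> + 1 / 2) * \<psi> x"
    by (subst eq_iff_diff_eq_0, subst (2) eq_iff_diff_eq_0)
       (simp add: scaleR_conv_of_real algebra_simps add_divide_distrib diff_divide_distrib)
  finally show ?thesis by (simp add: q_def)
qed

(* The eigenvalue equation says exactly that p(x,t) = exp (-mu t) * gauge_factor x * psi x solves
   the forward equation  dp/dt = - d/dx (drift * p) + d^2 p/dx^2  of the diffusion off x = 0. *)
lemma separated_solution_iff:
  fixes \<psi> \<psi>' \<psi>'' :: "real \<Rightarrow> complex" and \<beta> \<eta> \<mu> :: real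
  assumes "x \<noteq> 0"
    and "\<And>y. y \<noteq> 0 \<Longrightarrow> (\<psi> has_vector_derivative \<psi>' y) (at y)"
    and "\<And>y. y \<noteq> 0 \<Longrightarrow> (\<psi>' has_vector_derivative \<psi>'' y) (at y)"
  defines "p \<equiv> (\<lambda>y t. (exp (- \<mu> * t) * gauge_factor \<beta> \<eta> y) *\<^sub>R \<psi> y)"
  shows "vector_derivative (\<lambda>u. p x u) (at t) =
           - vector_derivative (\<lambda>y. drift \<beta> \<eta> y *\<^sub>R p y t) (at x)
           + vector_derivative (\<lambda>y. vector_derivative (\<lambda>z. p z t) (at y)) (at x)
         \<longleftrightarrow> - \<psi>'' x + of_real (potential \<beta> \<eta> x) * \<psi> x = of_real (\<mu> + 1 / 2) * \<psi> x"
proof (cases "x < 0")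
  case True
  show ?thesis unfolding p_def
    using True assms(2,3)
    by (subst separated_solution_aux [where S = "{..<0}" and s = 1 and \<beta> = \<beta>
          and \<psi>' = \<psi>' and \<psi>'' = \<psi>''])
       (auto simp: gauge_factor_def drift_def potential_def exp_add [symmetric])
next
  case False
  then show ?thesis unfolding p_def
    using assms(1-3)
    by (subst separated_solution_aux [where S = "{0<..}" and s = \<eta> and \<beta> = \<beta>
          and \<psi>' = \<psi>' and \<psi>'' = \<psi>''])
       (auto simp: gauge_factor_def drift_def potential_def exp_add [symmetric])
qed

end

theory Submission
  imports Defs "HOL-Complex_Analysis.Complex_Analysis" "HOL-Probability.Distributions"
    "HOL-Real_Asymp.Real_Asymp"
begin

text \<open>
  Translating the contour integral of \<open>D\<^sub>\<nu>\<close> along its own direction shows that it does not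
  depend on the abscissa; differentiating in the abscissa then gives the three-term recurrence, hence
  Weber's equation. Choosing the abscissa \<open>x\<close> gives decay as \<open>x \<rightarrow> \<infinity>\<close>, and letting it tend to \<open>0\<close>
  gives the Gamma values of \<open>D\<^sub>\<nu>\<close> and \<open>D\<^sub>\<nu>'\<close> at \<open>0\<close>. A square integrable solution on a half line is unique
  up to a factor, so the eigenvalues \<open>\<mu>\<close> are exactly the zeros of the Wronskian at the interface, which
  is \<open>- char_fun (- \<mu>)\<close>. For large \<open>\<mu>\<close> both sides oscillate like a free wave whose total phase is
  asymptotically linear in \<open>\<mu>\<close>, so the Wronskian changes sign and a negative zero \<open>\<theta>\<close> exists; as
  \<open>char_fun\<close> is entire in \<open>\<theta>\<close> and not constant, its zeros are isolated and a largest negative one exists.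
\<close>

section \<open>Holomorphic parameter integrals\<close>

text \<open>One normalisation serves both half lines. For x > 0 the variable z = (\<beta> + \<eta>
  x) / sqrt \<eta> turns the eigenvalue equation into Weber's equation of order \<mu> / \<eta>; the
  shift (1 - \<eta>) / 2 in the potential is exactly what makes the constant terms fit. For x < 0
  the reflection x -> -x gives the same problem with slope 1, with -\<beta> for \<beta>, and with
  order \<mu>. Zero is itself a root of \<open>char_fun\<close>, belonging to the ground state. So a
  largest negative root exists only if the negative roots do not accumulate at 0, and the existence
  of any negative root has to come from elsewhere, here from large orders. The arguments of D stay
  fixed while the order grows; hence the asymptotics can start from the exact Gamma values at 0 and
  be carried to a fixed argument by the differential equation alone.\<close>

lemma has_field_derivative_integral:
  fixes f f' :: "complex \<Rightarrow> 'a \<Rightarrow> complex"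
  assumes r: "r > 0"
    and int: "\<And>z. z \<in> ball z0 r \<Longrightarrow> integrable M (f z)"
    and meas: "f' z0 \<in> borel_measurable M"
    and der: "\<And>z t. z \<in> ball z0 r \<Longrightarrow> ((\<lambda>z. f z t) has_field_derivative f' z t) (at z)"
    and bnd: "\<And>z t. z \<in> ball z0 r \<Longrightarrow> norm (f' z t) \<le> g t"
    and g: "integrable M g"
  shows "((\<lambda>z. LINT t|M. f z t) has_field_derivative (LINT t|M. f' z0 t)) (at z0)"
proof -
  have z0: "z0 \<in> ball z0 r" using r by simp
  have "((\<lambda>z. ((LINT t|M. f z t) - (LINT t|M. f z0 t)) / (z - z0)) \<longlongrightarrow> (LINT t|M. f' z0 t)) (at z0)"
    unfolding tendsto_at_iff_sequentially comp_def
  proof (intro allI impI)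
    fix X :: "nat \<Rightarrow> complex"
    assume X: "\<forall>i. X i \<in> UNIV - {z0}" "X \<longlonglongrightarrow> z0"
    have "eventually (\<lambda>i. X i \<in> ball z0 r) sequentially"
      using X(2) r by (intro topological_tendstoD) auto
    then obtain N where N: "\<And>i. i \<ge> N \<Longrightarrow> X i \<in> ball z0 r"
      by (auto simp: eventually_sequentially)
    \<comment> \<open>Dropping the first \<open>N\<close> terms keeps every point in the ball. There
      the mean value bound dominates each difference quotient by \<open>g\<close>, so dominated
      convergence applies along the sequence.\<close>
    define Y where "Y i = X (i + N)" for i
    have Y: "Y i \<in> ball z0 r" "Y i \<noteq> z0" for i
      using N[of "i + N"] X(1) by (auto simp: Y_def)
    have Yl: "Y \<longlonglongrightarrow> z0" unfolding Y_def by (rule LIMSEQ_ignore_initial_segment [OF X(2)])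
    have "(\<lambda>i. LINT t|M. (f (Y i) t - f z0 t) / (Y i - z0)) \<longlonglongrightarrow> (LINT t|M. f' z0 t)"
    proof (rule integral_dominated_convergence [where w = g])
      show "AE t in M. (\<lambda>i. (f (Y i) t - f z0 t) / (Y i - z0)) \<longlonglongrightarrow> f' z0 t"
      proof (rule AE_I2)
        fix t
        have "((\<lambda>z. (f z t - f z0 t) / (z - z0)) \<longlongrightarrow> f' z0 t) (at z0)"
          using der[OF z0, of t] by (simp add: has_field_derivative_iff)
        then show "(\<lambda>i. (f (Y i) t - f z0 t) / (Y i - z0)) \<longlonglongrightarrow> f' z0 t"
          using Y Yl unfolding tendsto_at_iff_sequentially comp_def by auto
      qed
      show "AE t in M. norm ((f (Y i) t - f z0 t) / (Y i - z0)) \<le> g t" for i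
      proof (rule AE_I2)
        fix t
        have "norm (f (Y i) t - f z0 t) \<le> g t * norm (Y i - z0)"
          by (rule field_differentiable_bound [where S = "ball z0 r" and f' = "\<lambda>z. f' z t"])
             (use der bnd Y z0 in \<open>auto intro: has_field_derivative_at_within\<close>)
        then show "norm ((f (Y i) t - f z0 t) / (Y i - z0)) \<le> g t"
          using Y by (simp add: norm_divide field_simps)
      qed
      show "(\<lambda>t. (f (Y i) t - f z0 t) / (Y i - z0)) \<in> borel_measurable M" for i
        using int[OF Y(1)[of i]] int[OF z0] by simp
    qed (use meas g in auto)
    then have "(\<lambda>i. ((LINT t|M. f (Y i) t) - (LINT t|M. f z0 t)) / (Y i - z0)) \<longlonglongrightarrow> (LINT t|M. f' z0 t)"
      using int[OF Y(1)] int[OF z0] by simp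
    then show "(\<lambda>i. ((LINT t|M. f (X i) t) - (LINT t|M. f z0 t)) / (X i - z0)) \<longlonglongrightarrow> (LINT t|M. f' z0 t)"
      unfolding Y_def by (rule LIMSEQ_offset)
  qed
  then show ?thesis by (simp add: has_field_derivative_iff)
qed

section \<open>Gaussian majorants for the contour kernel\<close>

lemma integrable_exp_linear_gaussian: "integrable lborel (\<lambda>t::real. exp (a * t - b * t\<^sup>2))" if "b > 0"
proof -
  \<comment> \<open>Completing the square: the integrand is a constant multiple of the normal
    density with mean \<open>m\<close> and variance \<open>s\<^sup>2\<close>.\<close>
  define s where "s = 1 / sqrt (2 * b)"
  define m where "m = a / (2 * b)"
  have s: "s > 0" using that by (simp add: s_def)
  have s2: "s\<^sup>2 = 1 / (2 * b)" using that by (simp add: s_def power_divide)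
  have "integrable lborel (normal_density m s)" using s by (rule integrable_normal_density)
  then have "integrable lborel (\<lambda>t. sqrt (2 * pi * s\<^sup>2) * exp (b * m\<^sup>2) * normal_density m s t)"
    by (intro integrable_mult_right) auto
  also have "(\<lambda>t. sqrt (2 * pi * s\<^sup>2) * exp (b * m\<^sup>2) * normal_density m s t) = (\<lambda>t. exp (a * t - b * t\<^sup>2))"
  proof
    fix t
    have "b * m\<^sup>2 - (t - m)\<^sup>2 / (2 * s\<^sup>2) = a * t - b * t\<^sup>2"
      using that unfolding s2 m_def by (simp add: field_simps power2_eq_square)
    then show "sqrt (2 * pi * s\<^sup>2) * exp (b * m\<^sup>2) * normal_density m s t = exp (a * t - b * t\<^sup>2)"
      using s by (simp add: normal_density_def exp_add [symmetric])
  qed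
  finally show ?thesis .
qed

text \<open>Using \<open>a\<close> both as constant and as slope lets a single number absorb all
  lower-order terms of a kernel estimate.\<close>

lemma integrable_exp_abs_gaussian: "integrable lborel (\<lambda>t::real. exp (a + a * \<bar>t\<bar> - b * t\<^sup>2))" if "b > 0"
proof (rule Bochner_Integration.integrable_bound)
  show "integrable lborel (\<lambda>t::real. exp a * (exp (a * t - b * t\<^sup>2) + exp (- a * t - b * t\<^sup>2)))"
    using that by (intro integrable_mult_right Bochner_Integration.integrable_add integrable_exp_linear_gaussian)
  have "exp (a + a * \<bar>t\<bar> - b * t\<^sup>2) \<le> exp a * (exp (a * t - b * t\<^sup>2) + exp (- a * t - b * t\<^sup>2))" for t
  proof -
    have "exp (a + a * \<bar>t\<bar> - b * t\<^sup>2) = exp a * exp (a * \<bar>t\<bar> - b * t\<^sup>2)"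
      by (simp add: exp_add [symmetric])
    also have "exp (a * \<bar>t\<bar> - b * t\<^sup>2) \<le> exp (a * t - b * t\<^sup>2) + exp (- a * t - b * t\<^sup>2)"
      by (cases "t \<ge> 0") auto
    finally show ?thesis by simp
  qed
  then show "AE t in lborel. norm (exp (a + a * \<bar>t\<bar> - b * t\<^sup>2)) \<le> norm (exp a * (exp (a * t - b * t\<^sup>2) + exp (- a * t - b * t\<^sup>2)))"
    by (intro AE_I2) (auto simp: abs_mult)
qed measurable

definition pc_kernel :: "complex \<Rightarrow> complex \<Rightarrow> complex \<Rightarrow> complex" where
  "pc_kernel \<nu> z u = u powr \<nu> * exp (- z * u) * exp (u\<^sup>2 / 2)"

text \<open>The base point is complex although its real part alone places the contour: this way the
  integral can be differentiated in \<open>w\<close>, and moving \<open>w\<close> vertically becomes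
  a shift of \<open>t\<close>. The factor \<i> is du/dt.\<close>

definition pc_integral :: "complex \<Rightarrow> complex \<Rightarrow> complex \<Rightarrow> complex" where
  "pc_integral \<nu> z w = (LINT t|lborel. \<i> * pc_kernel \<nu> z (w + \<i> * of_real t))"

text \<open>The logarithm is bounded crudely by a linear function of |u|, which suffices because
  powers of u only have to lose against a Gaussian; 1 / \<delta> accounts for small |u|.\<close>

lemma norm_Ln_le:
  assumes "Re u \<ge> \<delta>" "\<delta> > 0"
  shows "norm (Ln u) \<le> norm u + 1 / \<delta> + pi"
proof -
  have u: "u \<noteq> 0" and nu: "norm u \<ge> \<delta>" "norm u > 0" using assms complex_Re_le_cmod[of u] by auto
  have "norm (Ln u) \<le> \<bar>Re (Ln u)\<bar> + \<bar>Im (Ln u)\<bar>" by (rule cmod_le)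
  also have "\<bar>Im (Ln u)\<bar> \<le> pi" using Im_Ln_le_pi[OF u] mpi_less_Im_Ln[OF u] by auto
  also have "\<bar>Re (Ln u)\<bar> = \<bar>ln (norm u)\<bar>" using u by simp
  also have "\<bar>ln (norm u)\<bar> \<le> norm u + 1 / \<delta>"
  proof -
    have "ln (norm u) \<le> norm u" using nu ln_le_minus_one[of "norm u"] by linarith
    moreover have "- ln (norm u) \<le> 1 / norm u"
      using nu ln_le_minus_one[of "1 / norm u"] by (simp add: ln_div)
    moreover have "1 / norm u \<le> 1 / \<delta>" using nu assms by (simp add: frac_le)
    moreover have "1 / \<delta> > 0" "norm u \<ge> 0" using assms by auto
    ultimately show ?thesis unfolding abs_le_iff by linarith
  qed
  finally show ?thesis by simp
qed

text \<open>Only Re (u^2 / 2) is quadratic in t, and it contributes -t^2 / 2; everything else grows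
  at most linearly in |t|. The factor exp (N |Ln u|) stands in place of the power so that the kernel
  and its derivative in the order share the estimate.\<close>

lemma pc_kernel_bound_aux:
  fixes t :: real
  assumes "norm z \<le> N" "norm w \<le> N" "Re w \<ge> \<delta>" "\<delta> > 0" "N \<ge> 0"
  defines "u \<equiv> w + \<i> * of_real t"
    and "A \<equiv> N * (3 * N + 3 + 1 / \<delta> + pi)"
  shows "exp (N * norm (Ln u)) * norm (exp (- z * u) * exp (u\<^sup>2 / 2))
           \<le> exp (A + A * \<bar>t\<bar> - 1/2 * t\<^sup>2)"
proof -
  have nu: "norm u \<le> N + \<bar>t\<bar>" unfolding u_def
    using norm_triangle_ineq[of w "\<i> * of_real t"] assms(2) by (simp add: norm_mult)
  have L: "norm (Ln u) \<le> N + \<bar>t\<bar> + 1 / \<delta> + pi"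
    using norm_Ln_le[of \<delta> u] nu assms by (simp add: u_def)
  have "- Re (z * u) \<le> norm (z * u)" using abs_Re_le_cmod[of "z * u"] by linarith
  also have "\<dots> \<le> N * (N + \<bar>t\<bar>)" unfolding norm_mult using assms nu by (intro mult_mono) auto
  finally have a1: "- Re (z * u) \<le> N * (N + \<bar>t\<bar>)" .
  have a2: "Re (u\<^sup>2 / 2) \<le> N\<^sup>2 / 2 + N * \<bar>t\<bar> - t\<^sup>2 / 2"
  proof -
    have "Re (u\<^sup>2 / 2) = ((Re w)\<^sup>2 - (Im w)\<^sup>2 - 2 * Im w * t - t\<^sup>2) / 2"
      by (simp add: u_def power2_eq_square algebra_simps)
    moreover have "(Re w)\<^sup>2 \<le> N\<^sup>2" using assms abs_Re_le_cmod[of w] by (intro power2_le_iff_abs_le[THEN iffD2]) auto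
    moreover have "- (Im w * t) \<le> N * \<bar>t\<bar>"
    proof -
      have "- (Im w * t) \<le> \<bar>Im w\<bar> * \<bar>t\<bar>" by (simp add: abs_mult [symmetric])
      also have "\<dots> \<le> N * \<bar>t\<bar>" using assms abs_Im_le_cmod[of w] by (intro mult_right_mono) auto
      finally show ?thesis .
    qed
    moreover have "(Im w)\<^sup>2 \<ge> 0" by simp
    ultimately show ?thesis by argo
  qed
  have "exp (N * norm (Ln u)) * norm (exp (- z * u) * exp (u\<^sup>2 / 2))
      = exp (N * norm (Ln u) + - Re (z * u) + Re (u\<^sup>2 / 2))"
    by (simp add: norm_mult exp_add [symmetric])
  also have "\<dots> \<le> exp (N * (N + \<bar>t\<bar> + 1 / \<delta> + pi) + N * (N + \<bar>t\<bar>) + (N\<^sup>2 / 2 + N * \<bar>t\<bar> - t\<^sup>2 / 2))"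
    using L a1 a2 assms(5) by (intro exp_le_cancel_iff[THEN iffD2] add_mono mult_left_mono) auto
  also have "\<dots> \<le> exp (A + A * \<bar>t\<bar> - 1/2 * t\<^sup>2)"
  proof -
    \<comment> \<open>One \<open>N * \<bar>t\<bar>\<close> comes from the logarithm, one from
      \<open>z * u\<close>, and one from the cross term of \<open>u\<^sup>2 / 2\<close>.\<close>
    have "N * 3 * \<bar>t\<bar> \<le> A * \<bar>t\<bar>" unfolding A_def
      using assms(1-5) pi_gt_zero by (intro mult_right_mono mult_left_mono) auto
    moreover have "N * (N + 1 / \<delta> + pi) + N * N + N\<^sup>2 / 2 \<le> A"
      using assms(5) by (simp add: A_def algebra_simps power2_eq_square)
    ultimately show ?thesis by (simp add: algebra_simps)
  qed
  finally show ?thesis .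
qed

definition pc_majorant :: "real \<Rightarrow> real \<Rightarrow> real \<Rightarrow> real" where
  "pc_majorant N \<delta> t = (let A = N * (3 * N + 3 + 1 / \<delta> + pi) in exp (A + A * \<bar>t\<bar> - 1 / 2 * t\<^sup>2))"

lemma integrable_pc_majorant: "integrable lborel (pc_majorant N \<delta>)"
  unfolding pc_majorant_def [abs_def] Let_def by (rule integrable_exp_abs_gaussian) simp

lemma norm_powr_le_exp: "u \<noteq> 0 \<Longrightarrow> norm (u powr \<nu>) \<le> exp (norm \<nu> * norm (Ln u))"
  unfolding powr_def using complex_Re_le_cmod[of "\<nu> * Ln u"] by (simp add: norm_mult)

lemma norm_pc_kernel_le:
  assumes "norm \<nu> \<le> N" "norm z \<le> N" "norm w \<le> N" "Re w \<ge> \<delta>" "\<delta> > 0"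
  shows "norm (pc_kernel \<nu> z (w + \<i> * of_real t)) \<le> pc_majorant N \<delta> t"
proof -
  define u where "u = w + \<i> * of_real t"
  have "Re u > 0" using assms by (simp add: u_def)
  then have u: "u \<noteq> 0" by auto
  have "norm (u powr \<nu>) \<le> exp (N * norm (Ln u))"
    using norm_powr_le_exp[OF u, of \<nu>] assms(1)
    by (rule_tac order_trans) (auto intro: mult_right_mono)
  then have "norm (pc_kernel \<nu> z u) \<le> exp (N * norm (Ln u)) * norm (exp (- z * u) * exp (u\<^sup>2 / 2))"
    unfolding pc_kernel_def norm_mult mult.assoc by (intro mult_right_mono) auto
  also have "\<dots> \<le> pc_majorant N \<delta> t"
    unfolding pc_majorant_def Let_def u_def
    using assms norm_ge_zero[of z] by (intro pc_kernel_bound_aux) linarith+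
  finally show ?thesis by (simp add: u_def)
qed

text \<open>Differentiating in \<nu> brings down Ln u. Since s \<le> exp s, this extra factor costs
  no more than one unit in the norm of \<nu>, hence the \<open>+ 1\<close> in the first
  hypothesis.\<close>

lemma norm_Ln_pc_kernel_le:
  assumes "norm \<nu> + 1 \<le> N" "norm z \<le> N" "norm w \<le> N" "Re w \<ge> \<delta>" "\<delta> > 0"
  defines "u t \<equiv> w + \<i> * of_real t"
  shows "norm (Ln (u t) * pc_kernel \<nu> z (u t)) \<le> pc_majorant N \<delta> t"
proof -
  define u where "u = w + \<i> * of_real t"
  have "Re u > 0" using assms by (simp add: u_def)
  then have u: "u \<noteq> 0" by auto
  have "norm (Ln u) \<le> exp (norm (Ln u))"
    using exp_ge_add_one_self[of "norm (Ln u)"] by linarith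
  then have "norm (Ln u * u powr \<nu>) \<le> exp (norm (Ln u)) * exp (norm \<nu> * norm (Ln u))"
    unfolding norm_mult using norm_powr_le_exp[OF u, of \<nu>] by (intro mult_mono) auto
  also have "\<dots> = exp ((norm \<nu> + 1) * norm (Ln u))" by (simp add: exp_add [symmetric] algebra_simps)
  also have "\<dots> \<le> exp (N * norm (Ln u))" using assms(1) by (auto intro: mult_right_mono)
  finally have "norm (Ln u * pc_kernel \<nu> z u)
      \<le> exp (N * norm (Ln u)) * norm (exp (- z * u) * exp (u\<^sup>2 / 2))"
    unfolding pc_kernel_def mult.assoc [symmetric] norm_mult [of _ "exp (u\<^sup>2 / 2)"]
      norm_mult [of _ "exp (- z * u)"] by (intro mult_right_mono) auto
  also have "\<dots> \<le> pc_majorant N \<delta> t"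
    unfolding pc_majorant_def Let_def u_def
    using assms norm_ge_zero[of z] by (intro pc_kernel_bound_aux) linarith+
  finally show ?thesis by (simp add: u_def assms)
qed

lemma borel_measurable_pc_kernel:
  assumes "Re w > 0"
  shows "(\<lambda>t. pc_kernel \<nu> z (w + \<i> * of_real t)) \<in> borel_measurable borel"
    and "(\<lambda>t. Ln (w + \<i> * of_real t) * pc_kernel \<nu> z (w + \<i> * of_real t)) \<in> borel_measurable borel"
proof -
  have nn: "w + \<i> * of_real t \<notin> \<real>\<^sub>\<le>\<^sub>0" for t
    using assms by (auto simp: complex_nonpos_Reals_iff)
  have n0: "w + \<i> * of_real t \<noteq> 0" for t using nn[of t] by auto
  have "continuous_on UNIV (\<lambda>t. pc_kernel \<nu> z (w + \<i> * of_real t))"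
    "continuous_on UNIV (\<lambda>t. Ln (w + \<i> * of_real t) * pc_kernel \<nu> z (w + \<i> * of_real t))"
    unfolding pc_kernel_def using assms nn n0 by (auto intro!: continuous_intros)
  then show "(\<lambda>t. pc_kernel \<nu> z (w + \<i> * of_real t)) \<in> borel_measurable borel"
    "(\<lambda>t. Ln (w + \<i> * of_real t) * pc_kernel \<nu> z (w + \<i> * of_real t)) \<in> borel_measurable borel"
    by (auto intro: borel_measurable_continuous_onI)
qed

lemma integrable_pc_kernel:
  assumes "Re w > 0"
  shows "integrable lborel (\<lambda>t. pc_kernel \<nu> z (w + \<i> * of_real t))"
proof (rule Bochner_Integration.integrable_bound)
  define N where "N = norm \<nu> + norm z + norm w"
  show "integrable lborel (pc_majorant N (Re w))" by (rule integrable_pc_majorant)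
  show "AE t in lborel. norm (pc_kernel \<nu> z (w + \<i> * of_real t)) \<le> norm (pc_majorant N (Re w) t)"
    using norm_pc_kernel_le[of \<nu> N z w "Re w"] assms
    by (intro AE_I2) (auto simp: N_def intro: order_trans[OF _ abs_ge_self])
qed (simp add: borel_measurable_pc_kernel[OF assms])

lemma pc_kernel_has_field_derivative:
  assumes "u \<notin> \<real>\<^sub>\<le>\<^sub>0"
  shows "((\<lambda>u. pc_kernel \<nu> z u) has_field_derivative
      (\<nu> * pc_kernel (\<nu> - 1) z u - z * pc_kernel \<nu> z u + pc_kernel (\<nu> + 1) z u)) (at u)"
proof -
  have u: "u \<noteq> 0" using assms by auto
  have 1: "((\<lambda>u. u powr \<nu>) has_field_derivative \<nu> * u powr (\<nu> - 1)) (at u)"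
    by (rule has_field_derivative_powr [OF assms])
  have 2: "((\<lambda>u. exp (- z * u)) has_field_derivative - z * exp (- z * u)) (at u)"
    by (auto intro!: derivative_eq_intros)
  have 3: "((\<lambda>u. exp (u\<^sup>2 / 2)) has_field_derivative u * exp (u\<^sup>2 / 2)) (at u)"
    by (auto intro!: derivative_eq_intros)
  show ?thesis unfolding pc_kernel_def
    by (rule DERIV_mult [OF DERIV_mult [OF 1 2] 3, THEN DERIV_cong])
       (simp add: powr_add u algebra_simps)
qed

lemma pc_kernel_add1: "u \<noteq> 0 \<Longrightarrow> pc_kernel (\<nu> + 1) z u = u * pc_kernel \<nu> z u"
  by (simp add: pc_kernel_def powr_add)

text \<open>Radius \<open>Re w / 2\<close> keeps all nearby contours at a uniform distance from the
  branch cut, so that one majorant serves the whole ball.\<close>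

lemma ball_bounds:
  assumes "w' \<in> ball w (Re w / 2)" "Re w > 0"
  shows "Re w' \<ge> Re w / 2" "norm w' \<le> 2 * norm w"
proof -
  have d: "norm (w - w') < Re w / 2" using assms by (simp add: dist_norm)
  then show "Re w' \<ge> Re w / 2" using complex_Re_le_cmod[of "w - w'"] by (simp add: )
  have "norm w' \<le> norm w + norm (w - w')" using norm_triangle_ineq4[of w "w - w'"] by simp
  then show "norm w' \<le> 2 * norm w" using d complex_Re_le_cmod[of w] norm_ge_zero[of "w-w'"] by linarith
qed

section \<open>Derivatives of the contour integral in argument, order and base point\<close>

lemma pc_integral_deriv_z:
  assumes w: "Re w > 0"
  shows "((\<lambda>z. pc_integral \<nu> z w) has_field_derivative - pc_integral (\<nu> + 1) z w) (at z)"
proof -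
  define N where "N = norm \<nu> + norm z + norm w + 1"
  define f' where "f' = (\<lambda>z t. - (\<i> * pc_kernel (\<nu> + 1) z (w + \<i> * of_real t)))"
  have u: "w + \<i> * of_real t \<noteq> 0" for t
  proof
    assume "w + \<i> * of_real t = 0"
    then have "Re (w + \<i> * of_real t) = 0" by simp
    then show False using w by simp
  qed
  have "((\<lambda>z. pc_integral \<nu> z w) has_field_derivative (LINT t|lborel. f' z t)) (at z)"
    unfolding pc_integral_def
  proof (rule has_field_derivative_integral [where r = 1 and g = "pc_majorant N (Re w)"])
    fix z' t assume z': "z' \<in> ball z 1"
    show "((\<lambda>z. \<i> * pc_kernel \<nu> z (w + \<i> * of_real t)) has_field_derivative f' z' t) (at z')"
      unfolding f'_def pc_kernel_add1[OF u] unfolding pc_kernel_def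
      by (rule derivative_eq_intros refl)+ (simp add: field_simps)
    have "norm z' \<le> norm z + 1" using z' norm_triangle_ineq4[of z "z - z'"] by (simp add: dist_norm)
    then show "norm (f' z' t) \<le> pc_majorant N (Re w) t"
      using norm_pc_kernel_le[of "\<nu> + 1" N z' w "Re w" t] w norm_triangle_ineq[of \<nu> 1]
      by (simp add: f'_def norm_mult N_def) (smt (verit) norm_ge_zero)
  qed (use w in \<open>auto simp: f'_def intro!: integrable_mult_right integrable_pc_kernel integrable_pc_majorant borel_measurable_times borel_measurable_pc_kernel\<close>)
  then show ?thesis by (simp add: f'_def pc_integral_def)
qed

lemma pc_integral_deriv_nu:
  assumes w: "Re w > 0"
  shows "((\<lambda>\<nu>. pc_integral \<nu> z w) has_field_derivative
     (LINT t|lborel. \<i> * (Ln (w + \<i> * of_real t) * pc_kernel \<nu> z (w + \<i> * of_real t)))) (at \<nu>)"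
proof -
  define N where "N = norm \<nu> + norm z + norm w + 2"
  define f' where "f' = (\<lambda>\<nu> t. \<i> * (Ln (w + \<i> * of_real t) * pc_kernel \<nu> z (w + \<i> * of_real t)))"
  have u: "w + \<i> * of_real t \<noteq> 0" for t
  proof
    assume "w + \<i> * of_real t = 0"
    then have "Re (w + \<i> * of_real t) = 0" by simp
    then show False using w by simp
  qed
  have "((\<lambda>\<nu>. pc_integral \<nu> z w) has_field_derivative (LINT t|lborel. f' \<nu> t)) (at \<nu>)"
    unfolding pc_integral_def
  proof (rule has_field_derivative_integral [where r = 1 and g = "pc_majorant N (Re w)"])
    fix \<nu>' t assume z': "\<nu>' \<in> ball \<nu> 1"
    show "((\<lambda>\<nu>. \<i> * pc_kernel \<nu> z (w + \<i> * of_real t)) has_field_derivative f' \<nu>' t) (at \<nu>')"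
      unfolding f'_def pc_kernel_def
      by (rule derivative_eq_intros refl u)+ (simp add: u field_simps)
    have "norm \<nu>' \<le> norm \<nu> + 1" using z' norm_triangle_ineq4[of \<nu> "\<nu> - \<nu>'"] by (simp add: dist_norm)
    then show "norm (f' \<nu>' t) \<le> pc_majorant N (Re w) t"
      using norm_Ln_pc_kernel_le[of \<nu>' N z w "Re w" t] w
      by (simp add: f'_def norm_mult N_def) (smt (verit) norm_ge_zero)
  qed (use w in \<open>auto simp: f'_def intro!: integrable_mult_right integrable_pc_kernel integrable_pc_majorant borel_measurable_times borel_measurable_pc_kernel\<close>)
  then show ?thesis by (simp add: f'_def)
qed

text \<open>Differentiating u^\<nu> exp (-z u) exp (u^2 / 2) in u yields kernels of orders \<nu> -
  1, \<nu> and \<nu> + 1. The derivative in the base point is therefore the combination that the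
  three-term recurrence asserts to vanish.\<close>

lemma pc_integral_deriv_w:
  assumes w: "Re w > 0"
  shows "((\<lambda>w. pc_integral \<nu> z w) has_field_derivative
     (\<nu> * pc_integral (\<nu> - 1) z w - z * pc_integral \<nu> z w + pc_integral (\<nu> + 1) z w)) (at w)"
proof -
  define N where "N = norm \<nu> + norm z + 2 * norm w + 2"
  define \<delta> where "\<delta> = Re w / 2"
  define k where "k = (\<lambda>u. \<nu> * pc_kernel (\<nu> - 1) z u - z * pc_kernel \<nu> z u + pc_kernel (\<nu> + 1) z u)"
  define f' where "f' = (\<lambda>w t. \<i> * k (w + \<i> * of_real t))"
  have "((\<lambda>w. pc_integral \<nu> z w) has_field_derivative (LINT t|lborel. f' w t)) (at w)"
    unfolding pc_integral_def
  proof (rule has_field_derivative_integral [where r = "Re w / 2" and g = "\<lambda>t. (norm \<nu> + norm z + 1) * pc_majorant N \<delta> t"])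
    fix w' t assume w': "w' \<in> ball w (Re w / 2)"
    note b = ball_bounds[OF w' w]
    have nn: "w' + \<i> * of_real t \<notin> \<real>\<^sub>\<le>\<^sub>0" using b w by (auto simp: complex_nonpos_Reals_iff)
    show "((\<lambda>w. \<i> * pc_kernel \<nu> z (w + \<i> * of_real t)) has_field_derivative f' w' t) (at w')"
      unfolding f'_def k_def
      using DERIV_cmult [OF pc_kernel_has_field_derivative [OF nn, of \<nu> z, THEN DERIV_shift [THEN iffD1]], of \<i>]
      by simp
    have K: "norm (pc_kernel \<mu> z (w' + \<i> * of_real t)) \<le> pc_majorant N \<delta> t" if "norm \<mu> \<le> norm \<nu> + 1" for \<mu>
      using that b w norm_ge_zero[of \<nu>] norm_ge_zero[of z] norm_ge_zero[of w]
      by (intro norm_pc_kernel_le) (simp_all add: N_def \<delta>_def del: norm_ge_zero)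
    have "norm (f' w' t) \<le> norm \<nu> * norm (pc_kernel (\<nu>-1) z (w' + \<i> * of_real t))
        + norm z * norm (pc_kernel \<nu> z (w' + \<i> * of_real t)) + norm (pc_kernel (\<nu>+1) z (w' + \<i> * of_real t))"
      using norm_triangle_ineq[of "\<nu> * pc_kernel (\<nu>-1) z (w' + \<i> * of_real t) - z * pc_kernel \<nu> z (w' + \<i> * of_real t)"
          "pc_kernel (\<nu>+1) z (w' + \<i> * of_real t)"]
        norm_triangle_ineq4[of "\<nu> * pc_kernel (\<nu>-1) z (w' + \<i> * of_real t)" "z * pc_kernel \<nu> z (w' + \<i> * of_real t)"]
      unfolding f'_def k_def norm_mult norm_ii mult_1 by linarith
    also have "\<dots> \<le> norm \<nu> * pc_majorant N \<delta> t + norm z * pc_majorant N \<delta> t + pc_majorant N \<delta> t"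
      using norm_triangle_ineq[of \<nu> 1] norm_triangle_ineq4[of \<nu> 1]
      by (intro add_mono mult_left_mono K) auto
    finally show "norm (f' w' t) \<le> (norm \<nu> + norm z + 1) * pc_majorant N \<delta> t" by (simp add: algebra_simps)
  next
    fix w' assume w': "w' \<in> ball w (Re w / 2)"
    show "integrable lborel (\<lambda>t. \<i> * pc_kernel \<nu> z (w' + \<i> * of_real t))"
      using ball_bounds[OF w' w] w by (intro integrable_mult_right integrable_pc_kernel) auto
  qed (use w borel_measurable_pc_kernel(1)[OF w] in \<open>auto simp only: f'_def k_def measurable_lborel1 measurable_lborel2 half_gt_zero_iff intro!: integrable_mult_right integrable_pc_majorant
      borel_measurable_times borel_measurable_const borel_measurable_add borel_measurable_diff borel_measurable_pc_kernel\<close>)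
  also have "(LINT t|lborel. f' w t) = (\<nu> * pc_integral (\<nu> - 1) z w - z * pc_integral \<nu> z w + pc_integral (\<nu> + 1) z w)"
  proof -
    have "(LINT t|lborel. f' w t) = (LINT t|lborel. \<nu> * (\<i> * pc_kernel (\<nu> - 1) z (w + \<i> * of_real t))
        - z * (\<i> * pc_kernel \<nu> z (w + \<i> * of_real t)) + \<i> * pc_kernel (\<nu> + 1) z (w + \<i> * of_real t))"
      unfolding f'_def k_def by (intro Bochner_Integration.integral_cong refl) (simp only: algebra_simps)
    also have "\<dots> = (\<nu> * pc_integral (\<nu> - 1) z w - z * pc_integral \<nu> z w + pc_integral (\<nu> + 1) z w)"
      unfolding pc_integral_def
      by (simp only: Bochner_Integration.integral_add Bochner_Integration.integral_diff Bochner_Integration.integrable_diff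
         integral_mult_right_zero integrable_mult_right integrable_pc_kernel[OF w])
    finally show ?thesis .
  qed
  finally show ?thesis .
qed

text \<open>Translating \<open>t\<close> shows that the integral is constant along vertical lines; being holomorphic in the
  base point it is then constant, which replaces both Cauchy's theorem and integration by parts.\<close>

lemma pc_integral_recurrence:
  assumes w: "Re w > 0"
  shows "\<nu> * pc_integral (\<nu> - 1) z w - z * pc_integral \<nu> z w + pc_integral (\<nu> + 1) z w = 0" (is "?D = 0")
proof -
  have tr: "pc_integral \<nu> z (w + \<i> * of_real s) = pc_integral \<nu> z w" for s
    unfolding pc_integral_def
    using lborel_integral_real_affine[of 1 "\<lambda>t. \<i> * pc_kernel \<nu> z (w + \<i> * of_real t)" s]
    by (simp add: algebra_simps)
  have "((\<lambda>s::real. pc_integral \<nu> z (w + \<i> * of_real s)) has_vector_derivative \<i> * ?D) (at 0)"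
  proof -
    have "((\<lambda>s::real. w + \<i> * of_real s) has_vector_derivative \<i>) (at 0)"
      by (auto intro!: derivative_eq_intros)
    from field_vector_diff_chain_at[OF this, of "pc_integral \<nu> z" ?D] pc_integral_deriv_w[OF w]
    show ?thesis by (simp add: o_def)
  qed
  moreover have "((\<lambda>s::real. pc_integral \<nu> z (w + \<i> * of_real s)) has_vector_derivative 0) (at 0)"
    unfolding tr by (rule has_vector_derivative_const)
  ultimately have "\<i> * ?D = 0" by (rule vector_derivative_unique_at)
  then show ?thesis by simp
qed

lemma pc_integral_eq:
  assumes "Re w > 0" "Re w' > 0"
  shows "pc_integral \<nu> z w = pc_integral \<nu> z w'"
proof -
  have "convex {w. Re w > 0}" by (rule convex_halfspace_Re_gt)
  then have "\<exists>c. \<forall>w\<in>{w. Re w > 0}. pc_integral \<nu> z w = c"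
    by (rule has_field_derivative_zero_constant)
       (use pc_integral_deriv_w pc_integral_recurrence in \<open>force intro: has_field_derivative_at_within\<close>)
  then show ?thesis using assms by auto
qed

section \<open>Parabolic cylinder functions\<close>

lemma parabolic_cylinder_D_eq:
  assumes "Re w > 0"
  shows "parabolic_cylinder_D \<nu> z = 1 / (\<i> * of_real (sqrt (2 * pi))) * exp (z\<^sup>2 / 4) * pc_integral \<nu> z w"
proof -
  have "vertical_line_integral 1 (\<lambda>u. u powr \<nu> * exp (- z * u) * exp (u\<^sup>2 / 2)) = pc_integral \<nu> z 1"
    unfolding vertical_line_integral_def pc_integral_def pc_kernel_def
    by (simp add: Complex_eq)
  also have "\<dots> = pc_integral \<nu> z w" by (rule pc_integral_eq) (use assms in auto)
  finally show ?thesis unfolding parabolic_cylinder_D_def by simp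
qed

definition pc_const :: complex where
  "pc_const = 1 / (\<i> * of_real (sqrt (2 * pi)))"

lemma parabolic_cylinder_D_eq_1:
  "parabolic_cylinder_D \<nu> z = pc_const * (exp (z\<^sup>2 / 4) * pc_integral \<nu> z 1)"
  by (subst parabolic_cylinder_D_eq[of 1]) (simp_all add: pc_const_def)

lemma parabolic_cylinder_D_recurrence:
  "\<nu> * parabolic_cylinder_D (\<nu> - 1) z - z * parabolic_cylinder_D \<nu> z + parabolic_cylinder_D (\<nu> + 1) z = 0"
proof -
  have "\<nu> * parabolic_cylinder_D (\<nu> - 1) z - z * parabolic_cylinder_D \<nu> z + parabolic_cylinder_D (\<nu> + 1) z
     = pc_const * (exp (z\<^sup>2 / 4) *
       (\<nu> * pc_integral (\<nu> - 1) z 1 - z * pc_integral \<nu> z 1 + pc_integral (\<nu> + 1) z 1))"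
    unfolding parabolic_cylinder_D_eq_1 by (simp only: algebra_simps)
  then show ?thesis by (simp add: pc_integral_recurrence)
qed

lemma parabolic_cylinder_D_has_field_derivative:
  "(parabolic_cylinder_D \<nu> has_field_derivative
     (z / 2 * parabolic_cylinder_D \<nu> z - parabolic_cylinder_D (\<nu> + 1) z)) (at z)"
proof -
  have e: "((\<lambda>z. exp (z\<^sup>2 / 4)) has_field_derivative z / 2 * exp (z\<^sup>2 / 4)) (at z)"
    by (auto intro!: derivative_eq_intros)
  have D: "parabolic_cylinder_D \<nu> = (\<lambda>z. pc_const * (exp (z\<^sup>2 / 4) * pc_integral \<nu> z 1))"
    by (intro ext) (rule parabolic_cylinder_D_eq_1)
  show ?thesis
    by (subst D, rule DERIV_cmult [OF DERIV_mult [OF e pc_integral_deriv_z], THEN DERIV_cong])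
       (simp_all add: parabolic_cylinder_D_eq_1 algebra_simps)
qed

lemma parabolic_cylinder_D'_eq:
  "parabolic_cylinder_D' \<nu> z = z / 2 * parabolic_cylinder_D \<nu> z - parabolic_cylinder_D (\<nu> + 1) z"
  by (rule DERIV_imp_deriv [OF parabolic_cylinder_D_has_field_derivative])

lemma parabolic_cylinder_D_deriv:
  "(parabolic_cylinder_D \<nu> has_field_derivative parabolic_cylinder_D' \<nu> z) (at z)"
  unfolding parabolic_cylinder_D'_eq by (rule parabolic_cylinder_D_has_field_derivative)

text \<open>Weber's equation: applying the derivative formula twice produces order \<nu> + 2, which
  the recurrence at \<nu> + 1 eliminates.\<close>

lemma parabolic_cylinder_D'_deriv:
  "(parabolic_cylinder_D' \<nu> has_field_derivative (z\<^sup>2 / 4 - \<nu> - 1 / 2) * parabolic_cylinder_D \<nu> z) (at z)"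
proof -
  have "((\<lambda>z. z / 2 * parabolic_cylinder_D \<nu> z - parabolic_cylinder_D (\<nu> + 1) z) has_field_derivative
     (1 / 2 * parabolic_cylinder_D \<nu> z + z / 2 * (z / 2 * parabolic_cylinder_D \<nu> z - parabolic_cylinder_D (\<nu> + 1) z)
       - (z / 2 * parabolic_cylinder_D (\<nu> + 1) z - parabolic_cylinder_D (\<nu> + 1 + 1) z))) (at z)"
    by (auto intro!: derivative_eq_intros parabolic_cylinder_D_has_field_derivative)
  also have "parabolic_cylinder_D (\<nu> + 1 + 1) z = z * parabolic_cylinder_D (\<nu> + 1) z - (\<nu> + 1) * parabolic_cylinder_D \<nu> z"
    using parabolic_cylinder_D_recurrence[of "\<nu> + 1" z] by (simp add: algebra_simps add_eq_0_iff)
  finally show ?thesis unfolding parabolic_cylinder_D'_eq [abs_def]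
    by (simp add: algebra_simps power2_eq_square)
qed

section \<open>Holomorphy in the order, reality and decay\<close>

lemma holomorphic_parabolic_cylinder_D_order: "(\<lambda>\<nu>. parabolic_cylinder_D \<nu> z) holomorphic_on A"
proof -
  have "(\<lambda>\<nu>. pc_integral \<nu> z 1) holomorphic_on A"
    unfolding holomorphic_on_def field_differentiable_def
    using pc_integral_deriv_nu[of 1] by (auto intro: has_field_derivative_at_within)
  then show ?thesis unfolding parabolic_cylinder_D_eq_1 by (intro holomorphic_intros)
qed

lemma holomorphic_parabolic_cylinder_D_order' [holomorphic_intros]:
  assumes "f holomorphic_on A" shows "(\<lambda>x. parabolic_cylinder_D (f x) z) holomorphic_on A"
  using holomorphic_on_compose[OF assms holomorphic_parabolic_cylinder_D_order] by (simp add: o_def)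

lemma holomorphic_parabolic_cylinder_D'_order [holomorphic_intros]:
  assumes "f holomorphic_on A" shows "(\<lambda>x. parabolic_cylinder_D' (f x) z) holomorphic_on A"
  unfolding parabolic_cylinder_D'_eq using assms by (intro holomorphic_intros)

text \<open>The contour is symmetric under conjugation, which sends t to -t and changes the sign of
  the factor \<i>. So the contour integral is purely imaginary, and the 1 / \<i> in
  \<open>pc_const\<close> makes the product real.\<close>

lemma parabolic_cylinder_D_in_Reals: "parabolic_cylinder_D (of_real \<nu>) (of_real x) \<in> \<real>"
proof -
  let ?k = "\<lambda>t. pc_kernel (of_real \<nu>) (of_real x) (1 + \<i> * of_real t)"
  have k: "cnj (?k t) = ?k (- t)" for t
    by (simp add: pc_kernel_def cnj_powr exp_cnj)
  have "cnj (pc_integral (of_real \<nu>) (of_real x) 1) = (LINT t|lborel. - (\<i> * ?k (- t)))"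
    unfolding pc_integral_def
    by (rule trans [OF Bochner_Integration.integral_cnj [symmetric]], intro Bochner_Integration.integral_cong refl)
       (simp only: complex_cnj_mult k complex_cnj_i mult_minus_left)
  also have "\<dots> = - (LINT t|lborel. \<i> * ?k (- t))"
    by (rule integral_minus)
  also have "(LINT t|lborel. \<i> * ?k (- t)) = pc_integral (of_real \<nu>) (of_real x) 1"
    unfolding pc_integral_def using lborel_integral_real_affine[of "-1" "\<lambda>t. \<i> * ?k t" 0] by simp
  finally have "cnj (parabolic_cylinder_D (of_real \<nu>) (of_real x)) = parabolic_cylinder_D (of_real \<nu>) (of_real x)"
    unfolding parabolic_cylinder_D_eq_1 by (simp add: pc_const_def exp_cnj)
  then show ?thesis by (simp add: Reals_cnj_iff)
qed

lemma parabolic_cylinder_D'_in_Reals: "parabolic_cylinder_D' (of_real \<nu>) (of_real x) \<in> \<real>"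
  unfolding parabolic_cylinder_D'_eq
  using parabolic_cylinder_D_in_Reals[of \<nu> x] parabolic_cylinder_D_in_Reals[of "\<nu> + 1" x]
  by (auto intro!: Reals_diff Reals_mult)

text \<open>Integrating along \<open>Re u = x\<close>, the line through the saddle point, gives the decay at infinity.\<close>

lemma parabolic_cylinder_D_decay:
  "\<exists>K. \<forall>x\<ge>1. norm (parabolic_cylinder_D \<nu> (of_real x)) \<le> K * exp (norm \<nu> * x - x\<^sup>2 / 4)"
proof -
  define n where "n = norm \<nu>"
  define g where "g t = exp (n * (1 + pi)) * exp (n * \<bar>t\<bar> - 1 / 2 * t\<^sup>2)" for t :: real
  have "integrable lborel (\<lambda>t::real. exp (- n) * exp (n + n * \<bar>t\<bar> - 1 / 2 * t\<^sup>2))"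
    by (intro integrable_mult_right integrable_exp_abs_gaussian) simp
  then have "integrable lborel (\<lambda>t::real. exp (n * \<bar>t\<bar> - 1 / 2 * t\<^sup>2))"
    by (simp flip: exp_add)
  then have gi: "integrable lborel g" unfolding g_def [abs_def] by (rule integrable_mult_right)
  have *: "norm (parabolic_cylinder_D \<nu> (of_real x))
       \<le> ((LINT t|lborel. g t) / sqrt (2 * pi)) * exp (n * x - x\<^sup>2 / 4)" if "x \<ge> 1" for x
  proof -
    let ?k = "\<lambda>t. pc_kernel \<nu> (of_real x) (of_real x + \<i> * of_real t)"
    have k: "norm (?k t) \<le> exp (n * x - x\<^sup>2 / 2) * g t" for t
    proof -
      define u where "u = of_real x + \<i> * complex_of_real t"
      have Ru: "Re u = x" by (simp add: u_def)
      have u0: "u \<noteq> 0" using Ru that by auto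
      have "norm u \<le> x + \<bar>t\<bar>"
        using norm_triangle_ineq[of "of_real x" "\<i> * complex_of_real t"] that by (simp add: u_def norm_mult)
      then have L: "norm (Ln u) \<le> x + \<bar>t\<bar> + 1 + pi"
        using norm_Ln_le[of 1 u] Ru that by simp
      have "norm (u powr \<nu>) \<le> exp (n * norm (Ln u))"
        using norm_powr_le_exp[OF u0, of \<nu>] by (simp add: n_def)
      also have "\<dots> \<le> exp (n * (x + \<bar>t\<bar> + 1 + pi))"
        using L by (auto simp: n_def intro!: mult_left_mono)
      finally have p: "norm (u powr \<nu>) \<le> exp (n * (x + \<bar>t\<bar> + 1 + pi))" .
      \<comment> \<open>On this line the terms linear in t cancel in the real part. The remaining
        exp (-x^2 / 2), multiplied by the prefactor exp (x^2 / 4), gives the decay rate.\<close>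
      have "Re (- of_real x * u) + Re (u\<^sup>2 / 2) = - (x\<^sup>2) / 2 - t\<^sup>2 / 2"
        by (simp add: u_def power2_eq_square field_simps)
      then have q: "norm (exp (- of_real x * u) * exp (u\<^sup>2 / 2)) = exp (- (x\<^sup>2) / 2 - t\<^sup>2 / 2)"
        by (simp only: norm_exp_eq_Re plus_complex.sel exp_add [symmetric])
      have "norm (pc_kernel \<nu> (of_real x) u) \<le> exp (n * (x + \<bar>t\<bar> + 1 + pi)) * exp (- (x\<^sup>2) / 2 - t\<^sup>2 / 2)"
        unfolding pc_kernel_def mult.assoc norm_mult [of "u powr \<nu>"] q using p by (intro mult_right_mono) auto
      also have "\<dots> = exp (n * x - x\<^sup>2 / 2) * g t"
        unfolding g_def exp_add [symmetric] by (simp add: algebra_simps)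
      finally show ?thesis by (simp add: u_def)
    qed
    have "norm (pc_integral \<nu> (of_real x) (of_real x)) \<le> (LINT t|lborel. exp (n * x - x\<^sup>2 / 2) * g t)"
      unfolding pc_integral_def using gi k that
      by (intro order_trans [OF integral_norm_bound] Bochner_Integration.integral_mono)
         (auto simp: norm_mult intro!: integrable_mult_right integrable_norm integrable_pc_kernel)
    then have I: "norm (pc_integral \<nu> (of_real x) (of_real x)) \<le> exp (n * x - x\<^sup>2 / 2) * (LINT t|lborel. g t)"
      by simp
    have "norm (parabolic_cylinder_D \<nu> (of_real x))
      = 1 / sqrt (2 * pi) * exp (x\<^sup>2 / 4) * norm (pc_integral \<nu> (of_real x) (of_real x))"
      using that by (subst parabolic_cylinder_D_eq[of "of_real x"])
        (auto simp: norm_mult norm_divide power2_eq_square)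
    also have "\<dots> \<le> 1 / sqrt (2 * pi) * exp (x\<^sup>2 / 4) * (exp (n * x - x\<^sup>2 / 2) * (LINT t|lborel. g t))"
      using I by (intro mult_left_mono) auto
    also have "\<dots> = ((LINT t|lborel. g t) / sqrt (2 * pi)) * (exp (x\<^sup>2 / 4) * exp (n * x - x\<^sup>2 / 2))" by simp
    also have "exp (x\<^sup>2 / 4) * exp (n * x - x\<^sup>2 / 2) = exp (n * x - x\<^sup>2 / 4)"
      by (simp flip: exp_add)
    finally show ?thesis .
  qed
  then show ?thesis unfolding n_def by blast
qed

lemma continuous_parabolic_cylinder_D: "continuous_on A (parabolic_cylinder_D \<nu>)"
  using DERIV_isCont[OF parabolic_cylinder_D_deriv] by (simp add: continuous_at_imp_continuous_on)

lemma parabolic_cylinder_D_square_integrable: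
  "set_integrable lborel {a..} (\<lambda>x. (norm (parabolic_cylinder_D \<nu> (of_real x)))\<^sup>2)"
proof -
  let ?f = "\<lambda>x::real. (norm (parabolic_cylinder_D \<nu> (of_real x)))\<^sup>2"
  have cont: "continuous_on A ?f" for A
    by (intro continuous_intros continuous_on_compose2[OF continuous_parabolic_cylinder_D[of UNIV]]) auto
  have meas: "?f \<in> borel_measurable borel" by (rule borel_measurable_continuous_onI[OF cont])
  obtain K where K: "\<And>x. x \<ge> 1 \<Longrightarrow> norm (parabolic_cylinder_D \<nu> (of_real x)) \<le> K * exp (norm \<nu> * x - x\<^sup>2 / 4)"
    using parabolic_cylinder_D_decay by blast
  have 1: "set_integrable lborel {a..1} ?f" by (rule borel_integrable_atLeastAtMost'[OF cont])
  have 2: "set_integrable lborel {1..} ?f" unfolding set_integrable_def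
  proof (rule Bochner_Integration.integrable_bound)
    show "integrable lborel (\<lambda>x::real. K\<^sup>2 * exp ((2 * norm \<nu>) * x - 1 / 2 * x\<^sup>2))"
      by (intro integrable_mult_right integrable_exp_linear_gaussian) simp
    show "AE x in lborel. norm (indicator {1..} x *\<^sub>R ?f x) \<le> norm (K\<^sup>2 * exp ((2 * norm \<nu>) * x - 1 / 2 * x\<^sup>2))"
    proof (rule AE_I2)
      fix x :: real
      have "?f x \<le> K\<^sup>2 * exp ((2 * norm \<nu>) * x - 1 / 2 * x\<^sup>2)" if "x \<ge> 1"
      proof -
        have "?f x \<le> (K * exp (norm \<nu> * x - x\<^sup>2 / 4))\<^sup>2" by (rule power_mono[OF K[OF that]]) simp
        then show ?thesis by (simp add: power_mult_distrib power2_eq_square algebra_simps flip: exp_add)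
      qed
      then show "norm (indicator {1..} x *\<^sub>R ?f x) \<le> norm (K\<^sup>2 * exp ((2 * norm \<nu>) * x - 1 / 2 * x\<^sup>2))"
        by (auto simp: indicator_def abs_mult)
    qed
  qed (use meas in \<open>auto intro!: borel_measurable_scaleR\<close>)
  show ?thesis
  proof (cases "a \<le> 1")
    case True
    then have "{a..} = {a..1} \<union> {1..}" by auto
    then show ?thesis using set_integrable_Un[OF 1 2] by simp
  next
    case False
    then show ?thesis using set_integrable_subset[OF 2, of "{a..}"] by simp
  qed
qed

lemma parabolic_cylinder_D_square_integrable_affine:
  assumes "s \<noteq> 0"
  shows "integrable lborel (\<lambda>x. indicator {a..} (b + s * x) * (norm (parabolic_cylinder_D \<nu> (of_real (b + s * x))))\<^sup>2)"
  using lborel_integrable_real_affine[OF parabolic_cylinder_D_square_integrable[of a \<nu>, unfolded set_integrable_def] assms, of b]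
  by simp

section \<open>Values at the origin\<close>

text \<open>The substitution s = t^2 / 2 in Euler's integral for Gamma gives the half line t \<ge>
  0; the integrand is even, so the whole line gives twice that value.\<close>

lemma has_bochner_integral_gaussian_abs_moment:
  assumes "\<nu> > 0"
  shows "has_bochner_integral lborel (\<lambda>t::real. \<bar>t\<bar> powr \<nu> * exp (- t\<^sup>2 / 2)) (2 powr ((\<nu> + 1) / 2) * Gamma ((\<nu> + 1) / 2))"
proof -
  define F where "F = (\<lambda>t::real. \<bar>t\<bar> powr \<nu> * exp (- t\<^sup>2 / 2))"
  define G where "G = Gamma ((\<nu> + 1) / 2)"
  have Fm [measurable]: "F \<in> borel_measurable borel" unfolding F_def by measurable
  let ?f = "\<lambda>s::real. s powr ((\<nu> + 1) / 2 - 1) / exp s"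
  have gi: "(?f has_integral G) {0..}" unfolding G_def
    by (rule Gamma_integral_real) (use assms in simp)
  then have f: "?f absolutely_integrable_on {0..}" "integral {0..} ?f = G"
    by (auto intro!: nonnegative_absolutely_integrable_1 simp: integral_unique)
  have img: "(\<lambda>t::real. t\<^sup>2 / 2) ` {0..} = {0..}"
  proof (safe, goal_cases)
    case (2 x)
    then show ?case by (intro image_eqI[of _ _ "sqrt (2 * x)"]) auto
  qed auto
  have inj: "inj_on (\<lambda>t::real. t\<^sup>2 / 2) {0..}"
    by (auto simp: inj_on_def)
  have sub: "(\<lambda>t. \<bar>t\<bar> *\<^sub>R ?f (t\<^sup>2 / 2)) absolutely_integrable_on {0..} \<and> integral {0..} (\<lambda>t. \<bar>t\<bar> *\<^sub>R ?f (t\<^sup>2 / 2)) = G"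
  proof -
    have "((\<lambda>t. t\<^sup>2 / 2) has_field_derivative t) (at t within {0..})" for t :: real
      by (auto intro!: derivative_eq_intros)
    from has_absolute_integral_change_of_variables_1' [OF _ this inj, of ?f G]
    show ?thesis using f by (simp add: img)
  qed
  have eq: "\<bar>t\<bar> *\<^sub>R ?f (t\<^sup>2 / 2) = 2 powr (- ((\<nu> - 1) / 2)) * F t" if "t \<ge> 0" for t
  proof (cases "t = 0")
    case False
    then have t: "t > 0" using that by simp
    have e: "t * t powr (\<nu> - 1) = t powr \<nu>" using t by (simp add: powr_diff)
    have "(t\<^sup>2 / 2) powr ((\<nu> - 1) / 2) = t powr (\<nu> - 1) / 2 powr ((\<nu> - 1) / 2)"
    proof -
      have "(t\<^sup>2) powr ((\<nu> - 1) / 2) = t powr (2 * ((\<nu> - 1) / 2))"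
        using t powr_powr[of t 2 "(\<nu> - 1) / 2"] by simp
      also have "2 * ((\<nu> - 1) / 2) = \<nu> - 1" by simp
      finally show ?thesis using t by (simp only: powr_divide)
    qed
    then show ?thesis using t e
      by (simp add: F_def powr_minus field_simps exp_minus)
  qed (use assms in \<open>simp add: F_def\<close>)
  have 1: "(\<lambda>t. 2 powr (- ((\<nu> - 1) / 2)) * F t) absolutely_integrable_on {0..}"
    by (rule set_integrable_cong [THEN iffD1, OF refl refl _ sub[THEN conjunct1]]) (use eq in auto)
  have 2: "integral {0..} (\<lambda>t. 2 powr (- ((\<nu> - 1) / 2)) * F t) = G"
    using sub Henstock_Kurzweil_Integration.integral_cong[of "{0..}" "\<lambda>t. \<bar>t\<bar> *\<^sub>R ?f (t\<^sup>2 / 2)" "\<lambda>t. 2 powr (- ((\<nu> - 1) / 2)) * F t"] eq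
    by auto
  have 3: "F absolutely_integrable_on {0..}"
    using set_integrable_mult_right [of "2 powr ((\<nu> - 1) / 2)", OF 1] 
    by (simp add: powr_minus field_simps)
  have 4: "integral {0..} F = 2 powr ((\<nu> - 1) / 2) * G"
    using 2 by (simp add: powr_minus field_simps)
  \<comment> \<open>The change of variables was made for gauge and Lebesgue integrals; the extension
    \<open>h\<close> by zero transfers the value to \<open>lborel\<close> and can be
    reflected.\<close>
  define h where "h t = indicator {0..} t * F t" for t
  have hm: "h \<in> borel_measurable lborel" unfolding h_def [abs_def] by measurable
  have hl: "integrable lebesgue h" using 3 by (simp add: set_integrable_def h_def [abs_def])
  then have hi: "integrable lborel h" using hm by (simp add: integrable_completion)
  have "(LINT t|lborel. h t) = (LINT t|lebesgue. h t)"
    using hm by (simp add: integral_completion)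
  also have "\<dots> = integral {0..} F"
    using set_lebesgue_integral_eq_integral(2)[OF 3] by (simp add: set_lebesgue_integral_def h_def)
  finally have hv: "(LINT t|lborel. h t) = 2 powr ((\<nu> - 1) / 2) * G" using 4 by simp
  have "has_bochner_integral lborel (\<lambda>t. h t + h (- t)) (2 powr ((\<nu> - 1) / 2) * G + 2 powr ((\<nu> - 1) / 2) * G)"
  proof (rule has_bochner_integral_add)
    show "has_bochner_integral lborel h (2 powr ((\<nu> - 1) / 2) * G)"
      using hi hv by (simp add: has_bochner_integral_iff)
    show "has_bochner_integral lborel (\<lambda>t. h (- t)) (2 powr ((\<nu> - 1) / 2) * G)"
      using hi hv lborel_integrable_real_affine[of h "-1" 0] lborel_integral_real_affine[of "-1" h 0]
      by (simp add: has_bochner_integral_iff)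
  qed
  also have "(\<lambda>t. h t + h (- t)) = F"
    using assms by (auto simp: h_def F_def fun_eq_iff indicator_def)
  also have "2 powr ((\<nu> - 1) / 2) * G + 2 powr ((\<nu> - 1) / 2) * G = 2 powr ((\<nu> + 1) / 2) * G"
  proof -
    have "2 powr ((\<nu> + 1) / 2) = 2 * 2 powr ((\<nu> - 1) / 2)"
      using powr_add[of 2 1 "(\<nu> - 1) / 2"] by (simp add: field_simps)
    then show ?thesis by simp
  qed
  finally show ?thesis by (simp add: F_def G_def)
qed

lemma borel_measurable_pc_kernel_imaginary_axis:
  assumes "\<nu> > 0"
  shows "(\<lambda>t. \<i> * pc_kernel (of_real \<nu>) 0 (\<i> * of_real t)) \<in> borel_measurable borel"
proof (rule borel_measurable_continuous_onI)
  show "continuous_on UNIV (\<lambda>t. \<i> * pc_kernel (of_real \<nu>) 0 (\<i> * of_real t))"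
    unfolding pc_kernel_def using assms
    by (intro continuous_intros) (auto simp: complex_nonpos_Reals_iff)
qed

text \<open>The integral has the same value on every line Re u = c with c > 0, so c can be sent to 0
  by dominated convergence. Positivity of \<nu> keeps the power bounded near the branch
  point.\<close>

lemma pc_integral_imaginary_axis:
  assumes "\<nu> > 0"
  shows "pc_integral (of_real \<nu>) 0 1 = (LINT t|lborel. \<i> * pc_kernel (of_real \<nu>) 0 (\<i> * of_real t))"
proof -
  define c where "c n = inverse (real (Suc n))" for n
  have c: "c n > 0" "c n \<le> 1" for n by (auto simp: c_def field_simps)
  have cl: "c \<longlonglongrightarrow> 0" unfolding c_def [abs_def] by (rule LIMSEQ_inverse_real_of_nat)
  \<comment> \<open>The summand \<nu> comes from (1 + |t|)^\<nu> \<le> exp (\<nu> (1 + |t|)), and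
    1/2 from \<open>(c n)\<^sup>2 / 2\<close> with abscissa at most 1.\<close>
  define a where "a = \<nu> + 1/2"
  let ?k = "pc_kernel (of_real \<nu>) 0"
  have k0: "?k u = u powr of_real \<nu> * exp (u\<^sup>2 / 2)" for u by (simp add: pc_kernel_def)
  have "(\<lambda>n. LINT t|lborel. \<i> * ?k (of_real (c n) + \<i> * of_real t)) \<longlonglongrightarrow> (LINT t|lborel. \<i> * ?k (\<i> * of_real t))"
  proof (rule integral_dominated_convergence [where w = "\<lambda>t. exp (a + a * \<bar>t\<bar> - 1 / 2 * t\<^sup>2)"])
    show "integrable lborel (\<lambda>t::real. exp (a + a * \<bar>t\<bar> - 1 / 2 * t\<^sup>2))"
      by (rule integrable_exp_abs_gaussian) simp
    show "(\<lambda>t. \<i> * ?k (of_real (c n) + \<i> * of_real t)) \<in> borel_measurable lborel" for n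
      using borel_measurable_pc_kernel(1)[of "of_real (c n)"] c by simp
    \<comment> \<open>At t = 0 the limiting contour meets the branch point, where continuity of the
      kernel is not supplied by its derivative.\<close>
    have "AE t in lborel. t \<noteq> (0::real)" by (rule AE_lborel_singleton)
    then show "AE t in lborel. (\<lambda>n. \<i> * ?k (of_real (c n) + \<i> * of_real t)) \<longlonglongrightarrow> \<i> * ?k (\<i> * of_real t)"
    proof (rule AE_mp, intro AE_I2 impI)
      fix t :: real assume "t \<noteq> 0"
      then have "\<i> * of_real t \<notin> \<real>\<^sub>\<le>\<^sub>0" by (auto simp: complex_nonpos_Reals_iff)
      from DERIV_isCont [OF pc_kernel_has_field_derivative [OF this]]
      have "isCont ?k (\<i> * of_real t)" .
      moreover have "(\<lambda>n. of_real (c n) + \<i> * of_real t) \<longlonglongrightarrow> of_real 0 + \<i> * complex_of_real t"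
        by (intro tendsto_intros cl)
      ultimately show "(\<lambda>n. \<i> * ?k (of_real (c n) + \<i> * of_real t)) \<longlonglongrightarrow> \<i> * ?k (\<i> * of_real t)"
        using isCont_tendsto_compose[of "\<i> * of_real t" ?k "\<lambda>n. of_real (c n) + \<i> * of_real t" sequentially]
        by (intro tendsto_mult_left) simp
    qed
    show "AE t in lborel. norm (\<i> * ?k (of_real (c n) + \<i> * of_real t)) \<le> exp (a + a * \<bar>t\<bar> - 1 / 2 * t\<^sup>2)" for n
    proof (rule AE_I2)
      fix t :: real
      define u where "u = of_real (c n) + \<i> * complex_of_real t"
      have nu: "norm u \<le> 1 + \<bar>t\<bar>" unfolding u_def
        using norm_triangle_ineq[of "of_real (c n)" "\<i> * complex_of_real t"] c[of n] by (simp add: norm_mult)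
      have "norm (u powr of_real \<nu>) = norm u powr \<nu>" by (simp add: norm_powr_real_powr')
      also have "\<dots> \<le> (1 + \<bar>t\<bar>) powr \<nu>" using nu assms by (intro powr_mono2) auto
      also have "\<dots> = exp (\<nu> * ln (1 + \<bar>t\<bar>))" by (simp add: powr_def)
      also have "\<dots> \<le> exp (\<nu> * (1 + \<bar>t\<bar>))"
        using assms ln_add_one_self_le_self[of "\<bar>t\<bar>"] by (auto intro!: mult_left_mono)
      finally have p: "norm (u powr of_real \<nu>) \<le> exp (\<nu> * (1 + \<bar>t\<bar>))" .
      have "(c n)\<^sup>2 \<le> 1" using c[of n] by (simp add: power_le_one)
      then have q: "norm (exp (u\<^sup>2 / 2)) \<le> exp (1 / 2 - t\<^sup>2 / 2)"
        by (simp add: u_def power2_eq_square)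
      have "norm (?k u) \<le> exp (\<nu> * (1 + \<bar>t\<bar>)) * exp (1 / 2 - t\<^sup>2 / 2)"
        unfolding k0 norm_mult by (intro mult_mono p q) auto
      also have "\<dots> \<le> exp (a + a * \<bar>t\<bar> - 1 / 2 * t\<^sup>2)"
        unfolding exp_add [symmetric] by (simp add: a_def algebra_simps)
      finally show "norm (\<i> * ?k (of_real (c n) + \<i> * of_real t)) \<le> exp (a + a * \<bar>t\<bar> - 1 / 2 * t\<^sup>2)"
        by (simp add: u_def norm_mult)
    qed
    show "(\<lambda>t. \<i> * ?k (\<i> * of_real t)) \<in> borel_measurable lborel"
      using borel_measurable_pc_kernel_imaginary_axis[OF assms] by simp
  qed
  moreover have "(LINT t|lborel. \<i> * ?k (of_real (c n) + \<i> * of_real t)) = pc_integral (of_real \<nu>) 0 1" for n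
    unfolding pc_integral_def [symmetric] using c by (intro pc_integral_eq) auto
  ultimately have "(\<lambda>n::nat. pc_integral (of_real \<nu>) 0 1) \<longlonglongrightarrow> (LINT t|lborel. \<i> * ?k (\<i> * of_real t))"
    by (simp only:)
  then show ?thesis by (simp add: LIMSEQ_const_iff)
qed

text \<open>On the imaginary axis the principal powers at t and -t are |t|^\<nu> exp (\<i> \<pi>
  \<nu> / 2) and its conjugate. Pairing them leaves a cosine times the absolute Gaussian
  moment.\<close>

lemma pc_integral_zero_real:
  assumes "\<nu> > 0"
  shows "pc_integral (of_real \<nu>) 0 1 = \<i> * of_real (cos (pi * \<nu> / 2) * (2 powr ((\<nu> + 1) / 2) * Gamma ((\<nu> + 1) / 2)))"
proof -
  define F where "F t = \<i> * pc_kernel (of_real \<nu>) 0 (\<i> * of_real t)" for t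
  define m where "m t = \<bar>t\<bar> powr \<nu> * exp (- t\<^sup>2 / 2)" for t
  have pos: "F t + F (- t) = 2 * \<i> * of_real (cos (pi * \<nu> / 2) * m t)" if "t > 0" for t
  proof -
    have 1: "Ln (\<i> * of_real t) = of_real (ln t) + \<i> * of_real pi / 2"
      using that Ln_times_of_real[of t \<i>] by (simp add: mult.commute Ln_of_real)
    have 2: "Ln (\<i> * of_real (- t)) = of_real (ln t) - \<i> * of_real pi / 2"
      using that Ln_times_of_real[of t "- \<i>"] by (simp add: mult.commute Ln_of_real)
    have E: "exp (of_real \<nu> * of_real (ln t)) = complex_of_real (t powr \<nu>)"
      using that by (simp add: powr_def exp_of_real [symmetric])
    have p: "(\<i> * of_real t) powr of_real \<nu> = of_real (t powr \<nu>) * exp (\<i> * of_real (pi * \<nu> / 2))"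
    proof -
      have "of_real \<nu> * (of_real (ln t) + \<i> * of_real pi / 2)
          = of_real \<nu> * of_real (ln t) + \<i> * complex_of_real (pi * \<nu> / 2)" by (simp add: field_simps)
      moreover have "(\<i> * of_real t) powr of_real \<nu> = exp (of_real \<nu> * Ln (\<i> * of_real t))"
        using that by (simp add: powr_def [of "\<i> * of_real t"])
      ultimately show ?thesis by (simp only: 1 exp_add E)
    qed
    have n: "(\<i> * of_real (- t)) powr of_real \<nu> = of_real (t powr \<nu>) * exp (- (\<i> * of_real (pi * \<nu> / 2)))"
    proof -
      have "of_real \<nu> * (of_real (ln t) - \<i> * of_real pi / 2)
          = of_real \<nu> * of_real (ln t) + - (\<i> * complex_of_real (pi * \<nu> / 2))" by (simp add: field_simps)
      moreover have "(\<i> * of_real (- t)) powr of_real \<nu> = exp (of_real \<nu> * Ln (\<i> * of_real (- t)))"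
        using that by (simp add: powr_def [of "- (\<i> * of_real t)"])
      ultimately show ?thesis by (simp only: 2 exp_add E)
    qed
    have e: "exp ((\<i> * of_real t)\<^sup>2 / 2) = of_real (exp (- t\<^sup>2 / 2))" "exp ((\<i> * of_real (- t))\<^sup>2 / 2) = of_real (exp (- t\<^sup>2 / 2))"
      by (simp_all add: power_mult_distrib flip: exp_of_real)
    have "exp (\<i> * of_real (pi * \<nu> / 2)) + exp (- (\<i> * of_real (pi * \<nu> / 2))) = 2 * complex_of_real (cos (pi * \<nu> / 2))"
      by (subst cos_of_real [symmetric], subst cos_exp_eq) simp
    moreover have "F t + F (- t) = \<i> * of_real (t powr \<nu>) * of_real (exp (- t\<^sup>2 / 2)) *
       (exp (\<i> * of_real (pi * \<nu> / 2)) + exp (- (\<i> * of_real (pi * \<nu> / 2))))"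
      unfolding F_def pc_kernel_def p n e by (simp add: algebra_simps)
    ultimately show ?thesis using that by (simp add: m_def)
  qed
  have sym: "F t + F (- t) = 2 * \<i> * of_real (cos (pi * \<nu> / 2) * m t)" for t
  proof (cases t "0::real" rule: linorder_cases)
    case equal
    then show ?thesis using assms by (simp add: F_def pc_kernel_def m_def)
  next
    case less
    then show ?thesis using pos[of "- t"] by (simp add: m_def add.commute)
  qed (rule pos)
  have M: "has_bochner_integral lborel m (2 powr ((\<nu> + 1) / 2) * Gamma ((\<nu> + 1) / 2))"
    using has_bochner_integral_gaussian_abs_moment[OF assms] by (simp add: m_def [abs_def])
  have Fi: "integrable lborel F"
  proof (rule Bochner_Integration.integrable_bound)
    show "integrable lborel m" using M by (simp add: has_bochner_integral_iff)
    show "F \<in> borel_measurable lborel"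
      using borel_measurable_pc_kernel_imaginary_axis[OF assms] by (simp add: F_def [abs_def])
    show "AE t in lborel. norm (F t) \<le> norm (m t)"
      by (intro AE_I2) (simp add: F_def m_def pc_kernel_def norm_mult norm_powr_real_powr' power_mult_distrib)
  qed
  have "2 * (LINT t|lborel. F t) = (LINT t|lborel. F t) + (LINT t|lborel. F (- t))"
    using lborel_integral_real_affine[of "-1" F 0] by simp
  also have "\<dots> = (LINT t|lborel. F t + F (- t))"
    using Fi lborel_integrable_real_affine[OF Fi, of "-1" 0] by simp
  also have "\<dots> = 2 * \<i> * of_real (cos (pi * \<nu> / 2) * (LINT t|lborel. m t))"
    unfolding sym by (simp add: mult.assoc)
  also have "(LINT t|lborel. m t) = 2 powr ((\<nu> + 1) / 2) * Gamma ((\<nu> + 1) / 2)"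
    using M by (simp add: has_bochner_integral_iff)
  finally show ?thesis unfolding pc_integral_imaginary_axis[OF assms] F_def by simp
qed

lemma parabolic_cylinder_D_zero_real:
  assumes "\<nu> > 0"
  shows "parabolic_cylinder_D (of_real \<nu>) 0
     = of_real (2 powr (\<nu> / 2) / sqrt pi * cos (pi * \<nu> / 2) * Gamma ((\<nu> + 1) / 2))"
proof -
  have "parabolic_cylinder_D (of_real \<nu>) 0
    = pc_const * \<i> * of_real (cos (pi * \<nu> / 2) * (2 powr ((\<nu> + 1) / 2) * Gamma ((\<nu> + 1) / 2)))"
    using pc_integral_zero_real[OF assms] by (simp add: parabolic_cylinder_D_eq_1)
  also have "pc_const * \<i> = of_real (1 / sqrt (2 * pi))" by (simp add: pc_const_def field_simps)
  also have "of_real (1 / sqrt (2 * pi)) * complex_of_real (cos (pi * \<nu> / 2) * (2 powr ((\<nu> + 1) / 2) * Gamma ((\<nu> + 1) / 2)))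
     = of_real (1 / sqrt (2 * pi) * (cos (pi * \<nu> / 2) * (2 powr ((\<nu> + 1) / 2) * Gamma ((\<nu> + 1) / 2))))"
    by (rule of_real_mult [symmetric])
  also have "1 / sqrt (2 * pi) * (cos (pi * \<nu> / 2) * (2 powr ((\<nu> + 1) / 2) * Gamma ((\<nu> + 1) / 2)))
     = 2 powr (\<nu> / 2) / sqrt pi * cos (pi * \<nu> / 2) * Gamma ((\<nu> + 1) / 2)"
    by (simp add: add_divide_distrib powr_add powr_half_sqrt real_sqrt_mult)
  finally show ?thesis .
qed

text \<open>Both sides are entire in \<nu>, so the identity theorem extends the case of real \<nu> >
  0. Gamma's reflection formula turns the product of cosine and Gamma found there into a reciprocal
  Gamma value, which makes sense for every order.\<close>

theorem parabolic_cylinder_D_zero: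
  "parabolic_cylinder_D \<nu> 0 = 2 powr (\<nu> / 2) * of_real (sqrt pi) * rGamma ((1 - \<nu>) / 2)"
proof -
  define f where "f \<nu> = parabolic_cylinder_D \<nu> 0 - 2 powr (\<nu> / 2) * of_real (sqrt pi) * rGamma ((1 - \<nu>) / 2)" for \<nu>
  have "f \<nu> = 0"
  proof (rule analytic_continuation [where f = f and w = \<nu> and S = UNIV and U = "of_real ` {0<..}" and \<xi> = 1])
    show "f holomorphic_on UNIV" unfolding f_def [abs_def]
      by (intro holomorphic_intros holomorphic_rGamma') auto
    show "(1::complex) islimpt of_real ` {0<..}" unfolding islimpt_approachable
    proof (intro allI impI)
      fix e :: real assume "e > 0"
      then show "\<exists>x'\<in>complex_of_real ` {0<..}. x' \<noteq> 1 \<and> dist x' 1 < e"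
        by (intro bexI[of _ "of_real (1 + e / 2)"] conjI imageI) (auto simp: dist_norm simp flip: of_real_divide)
    qed
    fix z :: complex assume "z \<in> of_real ` {0<..}"
    then obtain x where x: "x > 0" "z = of_real x" by auto
    \<comment> \<open>With this \<open>g\<close>, 1 - g is the argument (1 - x) / 2 of the claim,
      and sin (\<pi> g) is the cosine in the real formula.\<close>
    define g where "g = (x + 1) / 2"
    have g: "g > 0" using x by (simp add: g_def)
    have G: "complex_of_real (Gamma g) * rGamma (of_real g) = 1"
      using Gamma_real_pos[OF g] by (simp add: rGamma_inverse_Gamma Gamma_complex_of_real)
    have "rGamma (of_real g) * rGamma (1 - of_real g) = sin (of_real pi * of_real g) / complex_of_real pi"
      by (rule rGamma_reflection_complex)
    also have "sin (of_real pi * of_real g) = complex_of_real (cos (pi * x / 2))"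
    proof -
      have "pi * g = pi * x / 2 + pi / 2" by (simp add: g_def field_simps)
      then have "sin (pi * g) = cos (pi * x / 2)" by (simp add: sin_add)
      then show ?thesis by (simp only: of_real_mult [symmetric] sin_of_real)
    qed
    finally have "of_real (Gamma g) * (rGamma (of_real g) * rGamma (1 - of_real g))
        = of_real (Gamma g) * (complex_of_real (cos (pi * x / 2)) / of_real pi)" by simp
    then have R: "rGamma (1 - of_real g) = complex_of_real (Gamma g * cos (pi * x / 2) / pi)"
      using G by (simp flip: mult.assoc)
    have z2: "(1 - z) / 2 = 1 - of_real g" using x by (simp add: g_def field_simps)
    have "2 powr (z / 2) * of_real (sqrt pi) * rGamma ((1 - z) / 2)
      = of_real (2 powr (x / 2) * sqrt pi * (Gamma g * cos (pi * x / 2) / pi))"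
      unfolding z2 R using x powr_of_real[of 2 "x/2"] by simp
    also have "2 powr (x / 2) * sqrt pi * (Gamma g * cos (pi * x / 2) / pi)
      = 2 powr (x / 2) / sqrt pi * cos (pi * x / 2) * Gamma g"
      by (simp add: field_simps)
    finally show "f z = 0" unfolding f_def x(2)
      using parabolic_cylinder_D_zero_real[OF x(1)] x(2) by (simp add: g_def)
  qed auto
  then show ?thesis by (simp add: f_def)
qed

lemma parabolic_cylinder_D'_zero:
  "parabolic_cylinder_D' \<nu> 0 = - (2 powr ((\<nu> + 1) / 2) * of_real (sqrt pi) * rGamma (- \<nu> / 2))"
  by (simp add: parabolic_cylinder_D'_eq parabolic_cylinder_D_zero)

lemma parabolic_cylinder_D'_zero_real:
  assumes "\<nu> > 0"
  shows "parabolic_cylinder_D' (of_real \<nu>) 0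
     = of_real (2 powr ((\<nu> + 1) / 2) / sqrt pi * sin (pi * \<nu> / 2) * Gamma (\<nu> / 2 + 1))"
proof -
  have g: "(\<nu> + 1 + 1) / 2 = \<nu> / 2 + 1" by simp
  have c: "cos (pi * (\<nu> + 1) / 2) = - sin (pi * \<nu> / 2)"
    by (simp add: distrib_left add_divide_distrib cos_add)
  have "parabolic_cylinder_D (of_real (\<nu> + 1)) 0
      = - of_real (2 powr ((\<nu> + 1) / 2) / sqrt pi * sin (pi * \<nu> / 2) * Gamma (\<nu> / 2 + 1))"
    using parabolic_cylinder_D_zero_real[of "\<nu> + 1"] assms unfolding c g by simp
  then show ?thesis by (simp add: parabolic_cylinder_D'_eq)
qed

text \<open>Both Gamma factors can vanish together only if \<nu> is at once an odd and an even
  natural number.\<close>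

lemma parabolic_cylinder_zero_nontrivial:
  "parabolic_cylinder_D \<nu> 0 \<noteq> 0 \<or> parabolic_cylinder_D' \<nu> 0 \<noteq> 0"
proof (rule ccontr)
  assume "\<not> ?thesis"
  then have "rGamma ((1 - \<nu>) / 2) = 0" "rGamma (- \<nu> / 2) = 0"
    by (auto simp: parabolic_cylinder_D_zero parabolic_cylinder_D'_zero)
  then obtain m n where "(1 - \<nu>) / 2 = - of_nat m" "- \<nu> / 2 = - of_nat n"
    by (auto simp: rGamma_eq_zero_iff elim!: nonpos_Ints_cases')
  then have "complex_of_nat (1 + 2 * m) = of_nat (2 * n)"
    by (simp add: field_simps)
  then have "1 + 2 * m = 2 * n" by (simp only: of_nat_eq_iff)
  then show False by presburger
qed

text \<open>All parabolic cylinder functions are evaluated at 0, and the powers of 2 in the two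
  products agree (\<open>CE\<close>). So \<open>char_fun\<close> is the Gamma expression times a
  factor without zeros.\<close>

theorem char_fun_zero_drift_iff:
  assumes "\<eta> > 0"
  shows "char_fun \<theta> \<eta> 0 = 0 \<longleftrightarrow>
     of_real (sqrt \<eta>) * rGamma (\<theta> / (2 * of_real \<eta>)) * rGamma ((1 + \<theta>) / 2)
       + rGamma (\<theta> / 2) * rGamma (1 / 2 + \<theta> / (2 * of_real \<eta>)) = 0" (is "_ \<longleftrightarrow> ?R = 0")
proof -
  define s :: complex where "s = of_real (sqrt pi)"
  define A :: complex where "A = 2 powr (- \<theta> / 2)"
  define B :: complex where "B = 2 powr ((- \<theta> / of_real \<eta> + 1) / 2)"
  define C :: complex where "C = 2 powr ((- \<theta> + 1) / 2)"
  define E :: complex where "E = 2 powr (- \<theta> / of_real \<eta> / 2)"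
  have nz: "s * s * (A * B) \<noteq> 0" by (simp add: s_def A_def B_def)
  have CE: "C * E = A * B"
    unfolding A_def B_def C_def E_def powr_add [symmetric]
    by (simp add: add_divide_distrib diff_divide_distrib algebra_simps)
  have args: "(1 - - \<theta>) / 2 = (1 + \<theta>) / 2" "- (- \<theta>) / 2 = \<theta> / 2"
     "- (- \<theta> / of_real \<eta>) / 2 = \<theta> / (2 * of_real \<eta>)"
     "(1 - - \<theta> / of_real \<eta>) / 2 = 1 / 2 + \<theta> / (2 * of_real \<eta>)"
    by (simp_all add: add_divide_distrib)
  have D: "parabolic_cylinder_D (- \<theta>) 0 = A * s * rGamma ((1 + \<theta>) / 2)"
    "parabolic_cylinder_D' (- \<theta>) 0 = - (C * s * rGamma (\<theta> / 2))"
    "parabolic_cylinder_D (- \<theta> / of_real \<eta>) 0 = E * s * rGamma (1 / 2 + \<theta> / (2 * of_real \<eta>))"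
    "parabolic_cylinder_D' (- \<theta> / of_real \<eta>) 0 = - (B * s * rGamma (\<theta> / (2 * of_real \<eta>)))"
    unfolding parabolic_cylinder_D_zero parabolic_cylinder_D'_zero args
    by (simp_all only: A_def B_def C_def E_def s_def)
  have alg: "- h * (A * s * p) * - (B * s * q) - - (C * s * u) * (E * s * v)
      = s * s * (A * B) * (h * q * p) + s * s * (C * E) * (u * v)" for h p q u v :: complex
    by (simp add: mult_ac)
  have "char_fun \<theta> \<eta> 0 = s * s * (A * B) * ?R"
    unfolding char_fun_def minus_zero of_real_0 div_0 D alg CE by (rule distrib_left [symmetric])
  then show ?thesis using nz by simp
qed

section \<open>Square integrable solutions\<close>

lemma has_real_derivative_inner:
  fixes f g :: "real \<Rightarrow> complex"
  assumes "(f has_vector_derivative f') (at x)" "(g has_vector_derivative g') (at x)"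
  shows "((\<lambda>x. f x \<bullet> g x) has_real_derivative (f x \<bullet> g' + f' \<bullet> g x)) (at x)"
  using bounded_bilinear.has_vector_derivative[OF bounded_bilinear_inner assms]
  by (simp add: has_real_derivative_iff_has_vector_derivative)

text \<open>Gronwall's argument: N = |y|^2 + |y'|^2 satisfies N' \<le> (1 + K) N, so exp (-(1 + K)
  x) N decreases from 0. Derivatives are taken inside the interval and continuity up to its ends,
  because at the interface the equation holds on one side at a time.\<close>

lemma linear_ode_zero_unique:
  fixes y y' :: "real \<Rightarrow> complex" and Q :: "real \<Rightarrow> real"
  assumes ab: "a \<le> b"
    and c: "continuous_on {a..b} y" "continuous_on {a..b} y'"
    and d: "\<And>x. x \<in> {a<..<b} \<Longrightarrow> (y has_vector_derivative y' x) (at x)"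
           "\<And>x. x \<in> {a<..<b} \<Longrightarrow> (y' has_vector_derivative of_real (Q x) * y x) (at x)"
    and Q: "continuous_on {a..b} Q"
    and z: "y a = 0" "y' a = 0"
  shows "y b = 0" "y' b = 0"
proof -
  have "y b = 0 \<and> y' b = 0"
  proof (cases "a = b")
    case False
    have "bounded (Q ` {a..b})" using Q by (intro compact_imp_bounded compact_continuous_image) auto
    then obtain K where K: "\<And>x. x \<in> {a..b} \<Longrightarrow> \<bar>Q x\<bar> \<le> K" by (force simp: bounded_iff)
    define N where "N x = y x \<bullet> y x + y' x \<bullet> y' x" for x
    define N' where "N' x = 2 * (1 + Q x) * (y x \<bullet> y' x)" for x
    have d2: "(y' has_vector_derivative Q x *\<^sub>R y x) (at x)" if "x \<in> {a<..<b}" for x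
      using d(2)[OF that] by (simp add: scaleR_conv_of_real)
    have Nd: "(N has_real_derivative N' x) (at x)" if "x \<in> {a<..<b}" for x
      unfolding N_def [abs_def] N'_def
      by (rule DERIV_add [OF has_real_derivative_inner [OF d(1) d(1)] has_real_derivative_inner [OF d2 d2], THEN DERIV_cong])
         (use that in \<open>auto simp: inner_commute algebra_simps\<close>)
    have Nb: "N' x \<le> (1 + K) * N x" if "x \<in> {a<..<b}" for x
    proof -
      have "0 \<le> (y x - y' x) \<bullet> (y x - y' x)" "0 \<le> (y x + y' x) \<bullet> (y x + y' x)" by simp_all
      then have *: "\<bar>2 * (y x \<bullet> y' x)\<bar> \<le> N x"
        by (simp add: N_def inner_diff_left inner_diff_right inner_add_left inner_add_right inner_commute)
      have "N' x \<le> \<bar>1 + Q x\<bar> * \<bar>2 * (y x \<bullet> y' x)\<bar>" 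
        unfolding N'_def abs_mult[symmetric] by (rule order_trans[OF _ abs_ge_self]) (simp add: algebra_simps)
      also have "\<dots> \<le> (1 + K) * N x" using * K[of x] that by (intro mult_mono) auto
      finally show ?thesis .
    qed
    have "exp (- (1 + K) * b) * N b \<le> exp (- (1 + K) * a) * N a"
    proof (rule DERIV_nonpos_imp_decreasing_open [OF ab])
      show "continuous_on {a..b} (\<lambda>x. exp (- (1 + K) * x) * N x)"
        unfolding N_def using c by (intro continuous_intros)
      fix x assume x: "a < x" "x < b"
      have "((\<lambda>x. exp (- (1 + K) * x) * N x) has_real_derivative exp (- (1 + K) * x) * (N' x - (1 + K) * N x)) (at x)"
        using x by (auto intro!: derivative_eq_intros Nd simp: algebra_simps)
      moreover have "exp (- (1 + K) * x) * (N' x - (1 + K) * N x) \<le> 0"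
        using Nb[of x] x by (auto simp: mult_le_0_iff)
      ultimately show "\<exists>d. ((\<lambda>x. exp (- (1 + K) * x) * N x) has_real_derivative d) (at x) \<and> d \<le> 0"
        by blast
    qed
    then have "N b \<le> 0" using z by (simp add: N_def mult_le_0_iff)
    moreover have "y b \<bullet> y b \<ge> 0" "y' b \<bullet> y' b \<ge> 0" by auto
    ultimately have "y b \<bullet> y b = 0" "y' b \<bullet> y' b = 0" unfolding N_def by linarith+
    then show ?thesis by simp
  qed (use z in auto)
  then show "y b = 0" "y' b = 0" by auto
qed

lemma not_integrable_indicator_Ici: "\<not> integrable lborel (indicator {a..} :: real \<Rightarrow> real)"
proof
  assume i: "integrable lborel (indicator {a..} :: real \<Rightarrow> real)"
  have "real n \<le> (LINT x|lborel. indicator {a..} x)" for n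
  proof -
    have "real n = (LINT x|lborel. indicator {a..a + real n} x)" by simp
    also have "\<dots> \<le> (LINT x|lborel. indicator {a..} x)"
      by (intro Bochner_Integration.integral_mono i integrable_real_indicator) (auto split: split_indicator)
    finally show ?thesis .
  qed
  then show False by (meson linorder_not_le reals_Archimedean2)
qed

text \<open>Two linearly independent square integrable solutions would combine to one with value and slope \<open>1\<close>
  at a point beyond which \<open>Q \<ge> 0\<close>; its modulus increases from there on.\<close>

lemma square_integrable_solutions_wronskian:
  fixes u u' v v' :: "real \<Rightarrow> complex" and Q :: "real \<Rightarrow> real"
  assumes c: "continuous_on {0..} u" "continuous_on {0..} u'" "continuous_on {0..} v" "continuous_on {0..} v'"
    and d: "\<And>x. x > 0 \<Longrightarrow> (u has_vector_derivative u' x) (at x)"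
           "\<And>x. x > 0 \<Longrightarrow> (u' has_vector_derivative of_real (Q x) * u x) (at x)"
           "\<And>x. x > 0 \<Longrightarrow> (v has_vector_derivative v' x) (at x)"
           "\<And>x. x > 0 \<Longrightarrow> (v' has_vector_derivative of_real (Q x) * v x) (at x)"
    and Q: "\<And>x. x \<ge> a \<Longrightarrow> Q x \<ge> 0" and a: "a > 0"
    and i: "integrable lborel (\<lambda>x. indicator {a..} x * (norm (u x))\<^sup>2)"
           "integrable lborel (\<lambda>x. indicator {a..} x * (norm (v x))\<^sup>2)"
  shows "u 0 * v' 0 = u' 0 * v 0"
proof -
  define W where "W x = u x * v' x - u' x * v x" for x
  have "norm (W a - W 0) \<le> 0"
  proof -
    \<comment> \<open>The Wronskian has zero derivative for x > 0 and is continuous down to 0, so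
      the mean value inequality with derivative 0 carries its value from 0 to
      \<open>a\<close>.\<close>
    have "\<exists>x\<in>{0<..<a}. norm (W a - W 0) \<le> norm ((a - 0) *\<^sub>R (0::complex))"
    proof (rule mvt_general [OF a, of W "\<lambda>_ t. t *\<^sub>R 0"])
      show "continuous_on {0..a} W" unfolding W_def
        using c by (intro continuous_intros; auto elim: continuous_on_subset)
      fix x :: real assume "0 < x"
      then have "(W has_vector_derivative 0) (at x)"
        unfolding W_def [abs_def]
        by (intro has_vector_derivative_diff [OF has_vector_derivative_mult [OF d(1) d(4)] has_vector_derivative_mult [OF d(2) d(3)], THEN has_vector_derivative_eq_rhs]) simp_all
      then show "(W has_derivative (\<lambda>t. t *\<^sub>R 0)) (at x)" by (simp add: has_vector_derivative_def)
    qed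
    then show ?thesis by simp
  qed
  then have W0: "W 0 = W a" by simp
  have "W a = 0"
  proof (rule ccontr)
    assume Wa: "W a \<noteq> 0"
    \<comment> \<open>Cramer's rule for the conditions y a = 1 and y' a = 1, with determinant
      \<open>W a\<close>.\<close>
    define p where "p = (v' a - v a) / W a"
    define q where "q = (u a - u' a) / W a"
    define y where "y x = p * u x + q * v x" for x
    define y' where "y' x = p * u' x + q * v' x" for x
    have "(v' a - v a) * u a + (u a - u' a) * v a = W a" "(v' a - v a) * u' a + (u a - u' a) * v' a = W a"
      by (simp_all add: W_def algebra_simps)
    then have ya: "y a = 1" "y' a = 1" using Wa unfolding y_def y'_def p_def q_def
      by (simp_all add: add_divide_distrib [symmetric])
    have yd: "(y has_vector_derivative y' x) (at x)" "(y' has_vector_derivative of_real (Q x) * y x) (at x)"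
      if "x > 0" for x
      unfolding y_def [abs_def] y'_def [abs_def]
      using d[OF that] by (auto intro!: derivative_eq_intros simp: algebra_simps)
    \<comment> \<open>The derivative of y \<bullet> y' is Q |y|^2 + |y'|^2 \<ge> 0 beyond
      \<open>a\<close>. As y \<bullet> y' is half the derivative of |y|^2, the modulus cannot
      decrease.\<close>
    have G: "y x \<bullet> y' x \<ge> 1" if "x \<ge> a" for x
    proof -
      have "y a \<bullet> y' a \<le> y x \<bullet> y' x"
      proof (rule DERIV_nonneg_imp_nondecreasing [OF that])
        fix t assume "a \<le> t" "t \<le> x"
        then have t: "t > 0" "Q t \<ge> 0" using a Q by auto
        have "((\<lambda>x. y x \<bullet> y' x) has_real_derivative (y t \<bullet> (of_real (Q t) * y t) + y' t \<bullet> y' t)) (at t)"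
          by (rule has_real_derivative_inner [OF yd [OF t(1)]])
        moreover have "y t \<bullet> (of_real (Q t) * y t) + y' t \<bullet> y' t \<ge> 0"
          using t(2) by (simp add: scaleR_conv_of_real [symmetric])
        ultimately show "\<exists>d. ((\<lambda>x. y x \<bullet> y' x) has_real_derivative d) (at t) \<and> d \<ge> 0" by blast
      qed
      then show ?thesis by (simp add: ya)
    qed
    have F: "(norm (y x))\<^sup>2 \<ge> 1" if "x \<ge> a" for x
    proof -
      have "y a \<bullet> y a \<le> y x \<bullet> y x"
      proof (rule DERIV_nonneg_imp_nondecreasing [OF that])
        fix t assume t: "a \<le> t" "t \<le> x"
        have "((\<lambda>x. y x \<bullet> y x) has_real_derivative (y t \<bullet> y' t + y' t \<bullet> y t)) (at t)"
          using a t by (intro has_real_derivative_inner yd) auto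
        moreover have "y t \<bullet> y' t + y' t \<bullet> y t \<ge> 0" using G[OF t(1)] by (simp add: inner_commute)
        ultimately show "\<exists>d. ((\<lambda>x. y x \<bullet> y x) has_real_derivative d) (at t) \<and> d \<ge> 0" by blast
      qed
      then show ?thesis by (simp add: ya power2_norm_eq_inner)
    qed
    have "integrable lborel (indicator {a..} :: real \<Rightarrow> real)"
    proof (rule Bochner_Integration.integrable_bound)
      show "integrable lborel (\<lambda>x. 2 * (norm p)\<^sup>2 * (indicator {a..} x * (norm (u x))\<^sup>2)
         + 2 * (norm q)\<^sup>2 * (indicator {a..} x * (norm (v x))\<^sup>2))"
        by (intro Bochner_Integration.integrable_add integrable_mult_right i)
      show "AE x in lborel. norm (indicator {a..} x :: real) \<le> norm (2 * (norm p)\<^sup>2 * (indicator {a..} x * (norm (u x))\<^sup>2)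
         + 2 * (norm q)\<^sup>2 * (indicator {a..} x * (norm (v x))\<^sup>2))"
      proof (rule AE_I2)
        fix x
        have "1 \<le> 2 * (norm p)\<^sup>2 * (norm (u x))\<^sup>2 + 2 * (norm q)\<^sup>2 * (norm (v x))\<^sup>2" if "x \<ge> a"
        proof -
          have "norm (y x) \<le> norm (p * u x) + norm (q * v x)" unfolding y_def by (rule norm_triangle_ineq)
          then have "(norm (y x))\<^sup>2 \<le> (norm (p * u x) + norm (q * v x))\<^sup>2" by (intro power_mono) auto
          also have "\<dots> \<le> 2 * (norm (p * u x))\<^sup>2 + 2 * (norm (q * v x))\<^sup>2"
            using zero_le_power2[of "norm (p * u x) - norm (q * v x)"] by (simp add: power2_eq_square algebra_simps)
          finally show ?thesis using F[OF that] by (simp add: norm_mult power_mult_distrib)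
        qed
        then show "norm (indicator {a..} x :: real) \<le> norm (2 * (norm p)\<^sup>2 * (indicator {a..} x * (norm (u x))\<^sup>2)
         + 2 * (norm q)\<^sup>2 * (indicator {a..} x * (norm (v x))\<^sup>2))"
          by (auto simp: indicator_def)
      qed
    qed simp
    then show False using not_integrable_indicator_Ici by blast
  qed
  then show ?thesis using W0 by (simp add: W_def)
qed

section \<open>Rescaled parabolic cylinder functions\<close>

lemma parabolic_cylinder_affine_deriv:
  fixes b s \<nu> :: real
  shows "((\<lambda>x. parabolic_cylinder_D (of_real \<nu>) (of_real (b + s * x))) has_vector_derivative
           of_real s * parabolic_cylinder_D' (of_real \<nu>) (of_real (b + s * x))) (at x)"
    and "((\<lambda>x. of_real s * parabolic_cylinder_D' (of_real \<nu>) (of_real (b + s * x))) has_vector_derivative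
           of_real (s\<^sup>2 * ((b + s * x)\<^sup>2 / 4 - \<nu> - 1 / 2)) * parabolic_cylinder_D (of_real \<nu>) (of_real (b + s * x))) (at x)"
proof -
  have g: "((\<lambda>x. complex_of_real (b + s * x)) has_vector_derivative of_real s) (at x)"
    by (auto intro!: derivative_eq_intros simp: has_vector_derivative_def scaleR_conv_of_real)
  show "((\<lambda>x. parabolic_cylinder_D (of_real \<nu>) (of_real (b + s * x))) has_vector_derivative
           of_real s * parabolic_cylinder_D' (of_real \<nu>) (of_real (b + s * x))) (at x)"
    using field_vector_diff_chain_at[OF g parabolic_cylinder_D_deriv] by (simp add: o_def)
  have "((\<lambda>x. of_real s * parabolic_cylinder_D' (of_real \<nu>) (of_real (b + s * x))) has_vector_derivative
      of_real s * (of_real s * (((of_real (b + s * x))\<^sup>2 / 4 - of_real \<nu> - 1 / 2) * parabolic_cylinder_D (of_real \<nu>) (of_real (b + s * x))))) (at x)"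
    using field_vector_diff_chain_at[OF g parabolic_cylinder_D'_deriv]
    by (intro has_vector_derivative_mult_right) (simp add: o_def)
  then show "((\<lambda>x. of_real s * parabolic_cylinder_D' (of_real \<nu>) (of_real (b + s * x))) has_vector_derivative
           of_real (s\<^sup>2 * ((b + s * x)\<^sup>2 / 4 - \<nu> - 1 / 2)) * parabolic_cylinder_D (of_real \<nu>) (of_real (b + s * x))) (at x)"
    by (simp add: power2_eq_square mult.assoc)
qed

text \<open>A common zero of D and D' would propagate along the real axis to 0 by uniqueness, where
  the Gamma values exclude it.\<close>

lemma parabolic_cylinder_nontrivial:
  fixes \<nu> x0 :: real
  shows "parabolic_cylinder_D (of_real \<nu>) (of_real x0) \<noteq> 0 \<or> parabolic_cylinder_D' (of_real \<nu>) (of_real x0) \<noteq> 0"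
proof (rule ccontr)
  assume "\<not> ?thesis"
  then have z: "parabolic_cylinder_D (of_real \<nu>) (of_real x0) = 0" "parabolic_cylinder_D' (of_real \<nu>) (of_real x0) = 0"
    by auto
  \<comment> \<open>Uniqueness transports zero data from left to right; for positive
    \<open>x0\<close> the axis is reflected so that the starting point lies to the left of
    0.\<close>
  define s :: real where "s = (if x0 \<le> 0 then 1 else - 1)"
  have s: "s\<^sup>2 = 1" "s * s = 1" "s * x0 \<le> 0" "s \<noteq> 0" by (auto simp: s_def)
  define y where "y x = parabolic_cylinder_D (of_real \<nu>) (of_real (0 + s * x))" for x
  define y' where "y' x = of_real s * parabolic_cylinder_D' (of_real \<nu>) (of_real (0 + s * x))" for x
  note yd = parabolic_cylinder_affine_deriv[where \<nu> = \<nu> and b = 0 and s = s, folded y_def y'_def, unfolded s(1)]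
  have "0 + s * (s * x0) = x0" using s by (simp flip: mult.assoc)
  then have y0: "y (s * x0) = 0" "y' (s * x0) = 0" unfolding y_def y'_def using z by (simp_all only: mult_zero_right)
  have c: "continuous_on A y" "continuous_on A y'" for A
    using yd by (auto intro!: continuous_at_imp_continuous_on has_vector_derivative_continuous)
  have Qc: "continuous_on {s * x0..0} (\<lambda>x. 1 * ((0 + s * x)\<^sup>2 / 4 - \<nu> - 1 / 2))"
    by (intro continuous_intros) auto
  have "y 0 = 0" "y' 0 = 0"
    by (rule linear_ode_zero_unique[OF s(3) c yd Qc y0])+
  then show False using parabolic_cylinder_zero_nontrivial[of "of_real \<nu>"] s by (simp add: y_def y'_def)
qed

section \<open>Eigenvalues and zeros of the characteristic function\<close>

text \<open>The rescaled D is a square integrable solution of the same equation, so its Wronskian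
  with u vanishes at 0. The product form of the conclusion covers a zero of D at the interface.
  General \<open>\<beta>\<close> and \<open>\<eta>\<close> let the lemma serve the reflected left
  half line too, with -\<beta> and slope 1.\<close>

lemma half_line_square_integrable_solution:
  fixes u u' :: "real \<Rightarrow> complex" and \<beta> \<eta> \<mu> :: real
  assumes \<eta>: "\<eta> > 0"
    and c: "continuous_on {0..} u" "continuous_on {0..} u'"
    and d: "\<And>x. x > 0 \<Longrightarrow> (u has_vector_derivative u' x) (at x)"
           "\<And>x. x > 0 \<Longrightarrow> (u' has_vector_derivative of_real ((\<beta> + \<eta> * x)\<^sup>2 / 4 - \<mu> - \<eta> / 2) * u x) (at x)"
    and i: "integrable lborel (\<lambda>x. (norm (u x))\<^sup>2)"
  shows "u 0 * (of_real (sqrt \<eta>) * parabolic_cylinder_D' (of_real (\<mu> / \<eta>)) (of_real (\<beta> / sqrt \<eta>)))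
       = u' 0 * parabolic_cylinder_D (of_real (\<mu> / \<eta>)) (of_real (\<beta> / sqrt \<eta>))"
proof -
  define b where "b = \<beta> / sqrt \<eta>"
  define s where "s = sqrt \<eta>"
  have s: "s > 0" "s\<^sup>2 = \<eta>" using \<eta> by (auto simp: s_def)
  define Q where "Q x = s\<^sup>2 * ((b + s * x)\<^sup>2 / 4 - \<mu> / \<eta> - 1 / 2)" for x
  have Q: "Q x = (\<beta> + \<eta> * x)\<^sup>2 / 4 - \<mu> - \<eta> / 2" for x
  proof -
    have "\<beta> + \<eta> * x = s * (b + s * x)" using s by (simp add: b_def s_def field_simps)
    then have "(\<beta> + \<eta> * x)\<^sup>2 = \<eta> * (b + s * x)\<^sup>2" by (simp only: power_mult_distrib s)
    then show ?thesis using \<eta> by (simp add: Q_def s field_simps)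
  qed
  define v where "v x = parabolic_cylinder_D (of_real (\<mu> / \<eta>)) (of_real (b + s * x))" for x
  define v' where "v' x = of_real s * parabolic_cylinder_D' (of_real (\<mu> / \<eta>)) (of_real (b + s * x))" for x
  note vd = parabolic_cylinder_affine_deriv[where \<nu> = "\<mu> / \<eta>" and b = b and s = s, folded v_def v'_def Q_def]
  have vc: "continuous_on A v" "continuous_on A v'" for A
    using vd by (auto intro!: continuous_at_imp_continuous_on has_vector_derivative_continuous)
  \<comment> \<open>Beyond this point \<beta> + \<eta> x is at least 2 sqrt (|\<mu>| + \<eta>), so a
    quarter of its square exceeds \<mu> + \<eta> / 2; the maximum with 1 makes \<open>a\<close>
    positive.\<close>
  define a where "a = max 1 ((2 * sqrt (\<bar>\<mu>\<bar> + \<eta>) - \<beta>) / \<eta>)"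
  have a: "a > 0" by (simp add: a_def)
  have Q0: "Q x \<ge> 0" if "x \<ge> a" for x
  proof -
    have "(2 * sqrt (\<bar>\<mu>\<bar> + \<eta>) - \<beta>) / \<eta> \<le> x" using that by (simp add: a_def)
    then have *: "2 * sqrt (\<bar>\<mu>\<bar> + \<eta>) \<le> \<beta> + \<eta> * x" using \<eta> by (simp add: field_simps)
    have "(2 * sqrt (\<bar>\<mu>\<bar> + \<eta>))\<^sup>2 \<le> (\<beta> + \<eta> * x)\<^sup>2"
      using * \<eta> by (intro power_mono) auto
    then have "4 * (\<bar>\<mu>\<bar> + \<eta>) \<le> (\<beta> + \<eta> * x)\<^sup>2" using \<eta> by (simp add: power_mult_distrib)
    then show ?thesis unfolding Q using \<eta> abs_ge_self[of \<mu>] by argo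
  qed
  have "u 0 * v' 0 = u' 0 * v 0"
  proof (rule square_integrable_solutions_wronskian [where Q = Q and a = a])
    show "(u' has_vector_derivative of_real (Q x) * u x) (at x)" if "x > 0" for x
      unfolding Q by (rule d(2)[OF that])
    have "integrable lborel (\<lambda>x. indicator {a..} x *\<^sub>R (norm (u x))\<^sup>2)"
      by (rule integrable_mult_indicator[OF _ i]) simp
    then show "integrable lborel (\<lambda>x. indicator {a..} x * (norm (u x))\<^sup>2)" by simp
    have "integrable lborel (\<lambda>x. indicator {a..} x *\<^sub>R (indicator {b + s * a..} (b + s * x) * (norm (v x))\<^sup>2))"
      unfolding v_def using s
      by (intro integrable_mult_indicator parabolic_cylinder_D_square_integrable_affine) auto
    also have "(\<lambda>x. indicator {a..} x *\<^sub>R (indicator {b + s * a..} (b + s * x) * (norm (v x))\<^sup>2))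
      = (\<lambda>x. indicator {a..} x * (norm (v x))\<^sup>2)"
      using s by (auto simp: indicator_def fun_eq_iff)
    finally show "integrable lborel (\<lambda>x. indicator {a..} x * (norm (v x))\<^sup>2)" .
  qed (use c vc vd d(1) Q0 a in auto)
  then show ?thesis by (simp add: v_def v'_def b_def s_def)
qed

lemma char_fun_real:
  "char_fun (of_real (- \<mu>)) \<eta> \<beta> =
     - (of_real (sqrt \<eta>) * parabolic_cylinder_D (of_real \<mu>) (of_real (- \<beta>))
         * parabolic_cylinder_D' (of_real (\<mu> / \<eta>)) (of_real (\<beta> / sqrt \<eta>))
     + parabolic_cylinder_D' (of_real \<mu>) (of_real (- \<beta>))
         * parabolic_cylinder_D (of_real (\<mu> / \<eta>)) (of_real (\<beta> / sqrt \<eta>)))"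
  unfolding char_fun_def by simp

text \<open>Each half line contributes one homogeneous linear relation between \<psi> 0 and \<psi>'
  0. The determinant of the pair is \<open>char_fun\<close> up to sign, and a nonzero solution
  forces it to vanish.\<close>

lemma eigenfunction_imp_char_fun_eq_0:
  assumes \<eta>: "\<eta> > 0" and e: "is_eigenfunction \<beta> \<eta> \<mu> \<psi>"
  shows "char_fun (of_real (- \<mu>)) \<eta> \<beta> = 0"
proof -
  from e obtain \<psi>' \<psi>'' where nz: "\<psi> \<noteq> (\<lambda>_. 0)" and i: "integrable lborel (\<lambda>x. (norm (\<psi> x))\<^sup>2)"
    and d1: "\<And>x. (\<psi> has_vector_derivative \<psi>' x) (at x)" and c': "isCont \<psi>' 0"
    and d2: "\<And>x. x \<noteq> 0 \<Longrightarrow> (\<psi>' has_vector_derivative \<psi>'' x) (at x)"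
    and eq: "\<And>x. x \<noteq> 0 \<Longrightarrow> - \<psi>'' x + of_real (potential \<beta> \<eta> x) * \<psi> x = of_real (\<mu> + 1 / 2) * \<psi> x"
    unfolding is_eigenfunction_def by blast
  have \<psi>'': "\<psi>'' x = of_real (potential \<beta> \<eta> x - \<mu> - 1 / 2) * \<psi> x" if "x \<noteq> 0" for x
  proof -
    have "\<psi>'' x = of_real (potential \<beta> \<eta> x) * \<psi> x - of_real (\<mu> + 1 / 2) * \<psi> x"
      using eq[OF that] by (metis add.commute add_diff_cancel_right' diff_conv_add_uminus diff_diff_eq2)
    then show ?thesis by (simp add: algebra_simps)
  qed
  have c1: "continuous_on A \<psi>" for A
    using d1 by (auto intro!: continuous_at_imp_continuous_on has_vector_derivative_continuous)
  have c2: "continuous_on A \<psi>'" for A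
  proof (intro continuous_at_imp_continuous_on ballI)
    fix x show "isCont \<psi>' x"
      using c' d2[of x] by (cases "x = 0") (auto intro: has_vector_derivative_continuous)
  qed
  define u where "u x = \<psi> (- x)" for x
  define u' where "u' x = - \<psi>' (- x)" for x
  have cu: "continuous_on A u" "continuous_on A u'" for A
    unfolding u_def u'_def
    by (intro continuous_on_minus continuous_on_compose2[OF c1[of UNIV]] continuous_on_compose2[OF c2[of UNIV]]
        continuous_on_id subset_UNIV)+
  have m: "((\<lambda>x. - x) has_vector_derivative - 1) (at x)" for x :: real
    by (auto intro!: derivative_eq_intros)
  have du: "(u has_vector_derivative u' x) (at x)" for x
    using vector_diff_chain_at[OF m d1, of x] by (simp add: u_def [abs_def] u'_def o_def)
  have du': "(u' has_vector_derivative \<psi>'' (- x)) (at x)" if "x \<noteq> 0" for x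
    using has_vector_derivative_minus[OF vector_diff_chain_at[OF m d2[of "- x"]]] that
    by (simp add: u'_def [abs_def] o_def)
  have ud2: "(u' has_vector_derivative of_real ((- \<beta> + 1 * x)\<^sup>2 / 4 - \<mu> - 1 / 2) * u x) (at x)" if "x > 0" for x
  proof -
    have P: "potential \<beta> \<eta> (- x) = (- \<beta> + 1 * x)\<^sup>2 / 4"
      using that by (simp add: potential_def power2_eq_square algebra_simps)
    show ?thesis using du'[of x] \<psi>''[of "- x"] that unfolding P [symmetric] by (simp add: u_def)
  qed
  have pd2: "(\<psi>' has_vector_derivative of_real ((\<beta> + \<eta> * x)\<^sup>2 / 4 - \<mu> - \<eta> / 2) * \<psi> x) (at x)" if "x > 0" for x
  proof -
    have P: "potential \<beta> \<eta> x - \<mu> - 1 / 2 = (\<beta> + \<eta> * x)\<^sup>2 / 4 - \<mu> - \<eta> / 2"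
      using that by (simp add: potential_def field_simps)
    show ?thesis using d2[of x] \<psi>''[of x] that unfolding P by simp
  qed
  define A where "A = parabolic_cylinder_D (of_real \<mu>) (of_real (- \<beta>))"
  define A' where "A' = parabolic_cylinder_D' (of_real \<mu>) (of_real (- \<beta>))"
  define B where "B = parabolic_cylinder_D (of_real (\<mu> / \<eta>)) (of_real (\<beta> / sqrt \<eta>))"
  define B' where "B' = of_real (sqrt \<eta>) * parabolic_cylinder_D' (of_real (\<mu> / \<eta>)) (of_real (\<beta> / sqrt \<eta>))"
  have R: "\<psi> 0 * B' = \<psi>' 0 * B" unfolding B_def B'_def
    by (rule half_line_square_integrable_solution[OF \<eta> c1 c2 d1 pd2 i])
  have ui: "integrable lborel (\<lambda>x. (norm (u x))\<^sup>2)"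
    using lborel_integrable_real_affine[OF i, of "-1" 0] by (simp add: u_def)
  have L: "\<psi> 0 * A' = - \<psi>' 0 * A"
    using half_line_square_integrable_solution[OF zero_less_one cu du ud2 ui]
    by (simp add: A_def A'_def u_def u'_def)
  \<comment> \<open>Zero data at the interface would extinguish \<psi> on the right directly and on
    the left through its reflection \<open>u\<close>.\<close>
  have nz0: "\<psi> 0 \<noteq> 0 \<or> \<psi>' 0 \<noteq> 0"
  proof (rule ccontr)
    assume "\<not> ?thesis"
    then have z: "\<psi> 0 = 0" "\<psi>' 0 = 0" "u 0 = 0" "u' 0 = 0" by (auto simp: u_def u'_def)
    have "\<psi> x = 0" if "x \<ge> 0" for x
      by (rule linear_ode_zero_unique(1)[OF that c1 c2 d1 pd2 _ z(1,2)]) (auto intro!: continuous_intros)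
    moreover have "u x = 0" if "x \<ge> 0" for x
      by (rule linear_ode_zero_unique(1)[OF that cu du ud2 _ z(3,4)]) (auto intro!: continuous_intros)
    ultimately have "\<psi> x = 0" for x by (metis u_def linorder_linear neg_0_le_iff_le minus_minus)
    then show False using nz by auto
  qed
  have "\<psi> 0 * (A * B' + A' * B) = 0" 
  proof -
    have "\<psi> 0 * (A * B' + A' * B) = A * (\<psi> 0 * B') + (\<psi> 0 * A') * B" by (simp add: algebra_simps)
    then show ?thesis unfolding L R by (simp add: algebra_simps)
  qed
  moreover have "\<psi>' 0 * (A * B' + A' * B) = 0"
  proof -
    have "\<psi>' 0 * (A * B' + A' * B) = - (- \<psi>' 0 * A) * B' + (\<psi>' 0 * B) * A'" by (simp add: algebra_simps)
    then show ?thesis unfolding L[symmetric] R[symmetric] by (simp add: algebra_simps)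
  qed
  ultimately have "A * B' + A' * B = 0" using nz0 by auto
  then show ?thesis unfolding char_fun_real by (simp add: A_def A'_def B_def B'_def algebra_simps)
qed

text \<open>A vanishing Wronskian makes the data of the two decaying solutions proportional at 0, so
  multiples of them can be glued with matching value and slope.\<close>

lemma char_fun_eq_0_imp_eigenfunction:
  assumes \<eta>: "\<eta> > 0" and e: "char_fun (of_real (- \<mu>)) \<eta> \<beta> = 0"
  shows "\<exists>\<psi>. is_eigenfunction \<beta> \<eta> \<mu> \<psi>"
proof -
  define b where "b = \<beta> / sqrt \<eta>"
  define s where "s = sqrt \<eta>"
  have s: "s > 0" "s\<^sup>2 = \<eta>" using \<eta> by (auto simp: s_def)
  define l where "l x = parabolic_cylinder_D (of_real \<mu>) (of_real (- \<beta> + - 1 * x))" for x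
  define l' where "l' x = of_real (- 1) * parabolic_cylinder_D' (of_real \<mu>) (of_real (- \<beta> + - 1 * x))" for x
  define v where "v x = parabolic_cylinder_D (of_real (\<mu> / \<eta>)) (of_real (b + s * x))" for x
  define v' where "v' x = of_real s * parabolic_cylinder_D' (of_real (\<mu> / \<eta>)) (of_real (b + s * x))" for x
  note vd = parabolic_cylinder_affine_deriv[where \<nu> = "\<mu> / \<eta>" and b = b and s = s, folded v_def v'_def]
  note ld = parabolic_cylinder_affine_deriv[where \<nu> = "\<mu>" and b = "- \<beta>" and s = "- 1", folded l_def l'_def]
  have vn: "v 0 \<noteq> 0 \<or> v' 0 \<noteq> 0"
    using parabolic_cylinder_nontrivial[of "\<mu> / \<eta>" b] s by (simp add: v_def v'_def)
  have ln: "l 0 \<noteq> 0 \<or> l' 0 \<noteq> 0"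
    using parabolic_cylinder_nontrivial[of \<mu> "- \<beta>"] by (simp add: l_def l'_def)
  have w: "l 0 * v' 0 = l' 0 * v 0"
    using e unfolding char_fun_real by (simp add: v_def v'_def l_def l'_def b_def s_def algebra_simps add_eq_0_iff)
  \<comment> \<open>Keeping p = 1, the factor q is the quotient of values, or the quotient of slopes
    if \<open>v 0\<close> vanishes; in that case the Wronskian forces \<open>l 0\<close> to vanish
    as well.\<close>
  obtain p q where pq: "p * l 0 = q * v 0" "p * l' 0 = q * v' 0" "p \<noteq> 0"
  proof (cases "v 0 = 0")
    case True
    then have "v' 0 \<noteq> 0" "l 0 = 0" using vn w by auto
    then show ?thesis using that[of 1 "l' 0 / v' 0"] True by simp
  next
    case False
    then show ?thesis using that[of 1 "l 0 / v 0"] w by (simp add: field_simps)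
  qed
  define \<psi> where "\<psi> x = (if x \<le> 0 then p * l x else q * v x)" for x
  define \<psi>' where "\<psi>' x = (if x \<le> 0 then p * l' x else q * v' x)" for x
  define \<psi>'' where "\<psi>'' x = of_real (potential \<beta> \<eta> x - \<mu> - 1 / 2) * \<psi> x" for x
  have pl: "((\<lambda>x. p * l x) has_vector_derivative p * l' x) (at x)" for x
    by (rule has_vector_derivative_mult_right[OF ld(1)])
  have qv: "((\<lambda>x. q * v x) has_vector_derivative q * v' x) (at x)" for x
    by (rule has_vector_derivative_mult_right[OF vd(1)])
  have d1: "(\<psi> has_vector_derivative \<psi>' x) (at x)" for x
  proof (cases x "0::real" rule: linorder_cases)
    case less
    have "(\<psi> has_vector_derivative p * l' x) (at x)"
      by (rule has_vector_derivative_transform_within_open[OF pl open_lessThan[of 0]])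
         (use less in \<open>simp_all add: \<psi>_def\<close>)
    then show ?thesis using less by (simp add: \<psi>'_def)
  next
    case greater
    have "(\<psi> has_vector_derivative q * v' x) (at x)"
      by (rule has_vector_derivative_transform_within_open[OF qv open_greaterThan[of 0]])
         (use greater in \<open>simp_all add: \<psi>_def\<close>)
    then show ?thesis using greater by (simp add: \<psi>'_def)
  next
    case equal
    \<comment> \<open>The closures of the two pieces meet only at 0, where \<open>pq\<close> makes
      both values and both slopes agree.\<close>
    have "((\<lambda>x. if x \<in> {..0} then p * l x else q * v x) has_vector_derivative
       (if x \<in> {..0} then p * l' x else q * v' x)) (at x within UNIV)"
    proof (rule has_vector_derivative_If_within_closures[where T = "{0<..}"])
      show "((\<lambda>x. p * l x) has_vector_derivative p * l' x) (at x within {..0} \<union> (closure {..0} \<inter> closure {0<..}))"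
        by (rule has_vector_derivative_at_within[OF pl])
      show "((\<lambda>x. q * v x) has_vector_derivative q * v' x) (at x within {0<..} \<union> (closure {..0} \<inter> closure {0<..}))"
        by (rule has_vector_derivative_at_within[OF qv])
    qed (use equal pq in auto)
    then show ?thesis by (simp add: \<psi>_def [abs_def] \<psi>'_def)
  qed
  have d2: "(\<psi>' has_vector_derivative \<psi>'' x) (at x)" if "x \<noteq> 0" for x
  proof (cases "x < 0")
    case True
    have "- 1 * (- 1) = (1::real)" "(- \<beta> + - 1 * x)\<^sup>2 = (\<beta> + x)\<^sup>2" by (simp_all add: power2_eq_square algebra_simps)
    then have "((\<lambda>x. p * l' x) has_vector_derivative \<psi>'' x) (at x)"
      using has_vector_derivative_mult_right[OF ld(2), of p x] True
      by (simp add: \<psi>''_def \<psi>_def potential_def algebra_simps)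
    then show ?thesis
      by (rule has_vector_derivative_transform_within_open[OF _ open_lessThan[of 0]])
         (use True in \<open>simp_all add: \<psi>'_def\<close>)
  next
    case False
    have "\<beta> + \<eta> * x = s * (b + s * x)" using s by (simp add: b_def s_def field_simps)
    then have b: "(\<beta> + \<eta> * x)\<^sup>2 = \<eta> * (b + s * x)\<^sup>2" by (simp only: power_mult_distrib s)
    have Q: "s\<^sup>2 * ((b + s * x)\<^sup>2 / 4 - \<mu> / \<eta> - 1 / 2) = potential \<beta> \<eta> x - \<mu> - 1 / 2"
      using that False \<eta> unfolding potential_def b by (simp add: s field_simps)
    have "((\<lambda>x. q * v' x) has_vector_derivative \<psi>'' x) (at x)"
      using has_vector_derivative_mult_right[OF vd(2), of q x] False that unfolding Q
      by (simp add: \<psi>''_def \<psi>_def mult_ac)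
    then show ?thesis
      by (rule has_vector_derivative_transform_within_open[OF _ open_greaterThan[of 0]])
         (use False that in \<open>simp_all add: \<psi>'_def\<close>)
  qed
  have "isCont \<psi>' 0"
  proof -
    have "continuous_on ({..0} \<union> {0..}) (\<lambda>x. if x \<le> 0 then p * l' x else q * v' x)"
    proof (rule continuous_on_cases)
      show "continuous_on {..0} (\<lambda>x. p * l' x)"
        by (intro continuous_at_imp_continuous_on ballI has_vector_derivative_continuous[OF has_vector_derivative_mult_right[OF ld(2)]])
      show "continuous_on {0..} (\<lambda>x. q * v' x)"
        by (intro continuous_at_imp_continuous_on ballI has_vector_derivative_continuous[OF has_vector_derivative_mult_right[OF vd(2)]])
      show "\<forall>x. x \<in> {..0} \<and> \<not> x \<le> 0 \<or> x \<in> {0..} \<and> x \<le> 0 \<longrightarrow> p * l' x = q * v' x"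
        using pq by auto
    qed auto
    moreover have "{..0} \<union> {0..} = (UNIV :: real set)" by auto
    ultimately show ?thesis by (simp add: continuous_on_eq_continuous_at \<psi>'_def [abs_def])
  qed
  moreover have "\<psi> \<noteq> (\<lambda>_. 0)"
  proof
    assume z: "\<psi> = (\<lambda>_. 0)"
    have "\<psi>' 0 = 0"
      using vector_derivative_unique_at[OF d1[of 0]] unfolding z by (metis has_vector_derivative_const)
    then show False using ln pq(3) fun_cong[OF z, of 0] by (simp add: \<psi>_def \<psi>'_def)
  qed
  moreover have "integrable lborel (\<lambda>x. (norm (\<psi> x))\<^sup>2)"
  proof (rule Bochner_Integration.integrable_bound)
    show "integrable lborel (\<lambda>x. (norm p)\<^sup>2 * (indicator {- \<beta>..} (- \<beta> + - 1 * x) * (norm (l x))\<^sup>2)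
        + (norm q)\<^sup>2 * (indicator {b..} (b + s * x) * (norm (v x))\<^sup>2))"
      unfolding l_def v_def using s
      by (intro Bochner_Integration.integrable_add integrable_mult_right parabolic_cylinder_D_square_integrable_affine) auto
    have "continuous_on UNIV (\<lambda>x. (norm (\<psi> x))\<^sup>2)"
      using d1 by (intro continuous_intros continuous_at_imp_continuous_on ballI) (auto intro: has_vector_derivative_continuous)
    then show "(\<lambda>x. (norm (\<psi> x))\<^sup>2) \<in> borel_measurable lborel"
      by (simp add: borel_measurable_continuous_onI)
    show "AE x in lborel. norm ((norm (\<psi> x))\<^sup>2) \<le> norm ((norm p)\<^sup>2 * (indicator {- \<beta>..} (- \<beta> + - 1 * x) * (norm (l x))\<^sup>2)
        + (norm q)\<^sup>2 * (indicator {b..} (b + s * x) * (norm (v x))\<^sup>2))"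
      using s by (intro AE_I2) (auto simp: \<psi>_def norm_mult power_mult_distrib indicator_def zero_le_mult_iff)
  qed
  moreover have "- \<psi>'' x + of_real (potential \<beta> \<eta> x) * \<psi> x = of_real (\<mu> + 1 / 2) * \<psi> x" for x
    by (simp add: \<psi>''_def algebra_simps)
  ultimately have "is_eigenfunction \<beta> \<eta> \<mu> \<psi>"
    unfolding is_eigenfunction_def using d1 d2 by blast
  then show ?thesis by blast
qed

theorem spectrum_iff_char_fun:
  assumes "\<eta> > 0"
  shows "\<mu> \<in> spectrum \<beta> \<eta> \<longleftrightarrow> char_fun (of_real (- \<mu>)) \<eta> \<beta> = 0"
  unfolding spectrum_def
  using eigenfunction_imp_char_fun_eq_0[OF assms] char_fun_eq_0_imp_eigenfunction[OF assms] by blast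

section \<open>Oscillation for large order\<close>

lemma Gamma_midpoint_log_convex:
  fixes x :: real
  assumes "x > 0"
  shows "(Gamma (x + 1 / 2))\<^sup>2 \<le> Gamma x * Gamma (x + 1)"
proof -
  have pos: "Gamma x > 0" "Gamma (x + 1) > 0" "Gamma (x + 1 / 2) > 0"
    using assms by (auto intro!: Gamma_real_pos)
  have "(ln \<circ> Gamma) ((1 - 1 / 2) *\<^sub>R x + (1 / 2) *\<^sub>R (x + 1)) \<le> (1 - 1 / 2) * (ln \<circ> Gamma) x + (1 / 2) * (ln \<circ> Gamma) (x + 1)"
    by (rule convex_onD[OF log_convex_Gamma_real]) (use assms in auto)
  also have "(1 - 1 / 2) *\<^sub>R x + (1 / 2) *\<^sub>R (x + 1) = x + 1 / 2" by (simp add: field_simps)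
  finally have "2 * ln (Gamma (x + 1 / 2)) \<le> ln (Gamma x) + ln (Gamma (x + 1))" by simp
  then have "ln ((Gamma (x + 1 / 2))\<^sup>2) \<le> ln (Gamma x * Gamma (x + 1))"
    using pos by (simp add: ln_mult ln_realpow)
  then show ?thesis using pos by (subst (asm) ln_le_cancel_iff) auto
qed

text \<open>Here \<rho> is the amplitude of D' at 0 divided by sqrt \<nu> times the amplitude of D
  at 0. Midpoint log-convexity of Gamma at \<nu> / 2 and at \<nu> / 2 + 1 / 2 sandwiches \<rho>^2
  between 1 and 1 + 1 / \<nu>.\<close>

lemma Gamma_half_step_ratio:
  assumes "\<nu> > (0::real)"
  defines "\<rho> \<equiv> sqrt 2 * Gamma (\<nu> / 2 + 1) / (sqrt \<nu> * Gamma ((\<nu> + 1) / 2))"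
  shows "\<bar>\<rho> - 1\<bar> \<le> 1 / \<nu>"
proof -
  define x where "x = \<nu> / 2"
  define g where "g = Gamma (x + 1 / 2)"
  define h where "h = Gamma (x + 1)"
  have x: "x > 0" using assms by (simp add: x_def)
  have pos: "g > 0" "h > 0" unfolding g_def h_def using x by (auto intro!: Gamma_real_pos)
  have h: "h = x * Gamma x" unfolding h_def using x Gamma_plus1[of x] nonpos_Ints_nonpos[of x] by fastforce
  have "g\<^sup>2 \<le> Gamma x * h" unfolding g_def h_def by (rule Gamma_midpoint_log_convex[OF x])
  then have 1: "x * g\<^sup>2 \<le> h\<^sup>2" using x h by (simp add: power2_eq_square mult_left_mono mult.assoc)
  have "h\<^sup>2 \<le> g * Gamma (x + 1 / 2 + 1)"
    using Gamma_midpoint_log_convex[of "x + 1 / 2"] x by (simp add: g_def h_def add.assoc)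
  also have "Gamma (x + 1 / 2 + 1) = (x + 1 / 2) * g"
    unfolding g_def using x Gamma_plus1[of "x + 1 / 2"] nonpos_Ints_nonpos[of "x + 1 / 2"] by fastforce
  finally have 2: "h\<^sup>2 \<le> (x + 1 / 2) * g\<^sup>2" by (simp add: power2_eq_square mult_ac)
  have \<rho>: "\<rho> = sqrt 2 * h / (sqrt \<nu> * g)"
    by (simp add: \<rho>_def g_def h_def x_def add_divide_distrib)
  have \<rho>2: "\<rho>\<^sup>2 = h\<^sup>2 / (x * g\<^sup>2)"
    unfolding \<rho> using assms by (simp add: power_mult_distrib power_divide x_def)
  have "\<rho>\<^sup>2 \<ge> 1" unfolding \<rho>2 using 1 x pos by simp
  moreover have \<rho>0: "\<rho> \<ge> 0" unfolding \<rho> using pos assms by simp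
  ultimately have \<rho>1: "\<rho> \<ge> 1" by (metis one_power2 power2_le_imp_le)
  have "\<rho> \<le> \<rho>\<^sup>2" using \<rho>1 by (simp add: power2_eq_square)
  also have "\<rho>\<^sup>2 \<le> (x + 1 / 2) / x" unfolding \<rho>2 using 2 x pos by (simp add: divide_simps)
  also have "\<dots> = 1 + 1 / \<nu>" using assms by (simp add: x_def field_simps)
  finally show ?thesis using \<rho>1 by simp
qed

text \<open>The vector \<open>D' + \<i> \<omega> D\<close>, rotated back by the phase \<open>\<omega> x\<close> of the free oscillator, is almost constant.\<close>

lemma parabolic_cylinder_phase_bound:
  fixes \<nu> Z x :: real
  assumes \<nu>: "\<nu> > 0" and x: "\<bar>x\<bar> \<le> Z"
  defines "\<omega> \<equiv> sqrt \<nu>" and "K \<equiv> Z\<^sup>2 / 4 + 1 / 2"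
  defines "P \<equiv> \<lambda>z. (parabolic_cylinder_D' (of_real \<nu>) z + \<i> * of_real \<omega> * parabolic_cylinder_D (of_real \<nu>) z) * exp (- \<i> * of_real \<omega> * z)"
  assumes small: "2 * (Z * K) \<le> \<omega>"
  shows "norm (P (of_real x) - P 0) \<le> 2 * (Z * K) / \<omega> * norm (P 0)"
proof -
  define S where "S = complex_of_real ` {-Z..Z}"
  have Z: "Z \<ge> 0" using x by simp
  have \<omega>: "\<omega> > 0" "\<omega>\<^sup>2 = \<nu>" using \<nu> by (auto simp: \<omega>_def)
  have K: "K > 0" unfolding K_def using zero_le_power2[of Z] by linarith
  have convex: "convex S" unfolding S_def
    by (rule convex_linear_image[OF bounded_linear.linear[OF bounded_linear_of_real]]) simp
  have compact: "compact S" unfolding S_def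
    by (intro compact_continuous_image continuous_intros) simp
  have S: "of_real x \<in> S" "0 \<in> S" using x Z by (auto simp: S_def image_iff)
  \<comment> \<open>The large term \<nu> D of Weber's equation cancels against (\<i> \<omega>)^2 D
    produced by the rotation; what remains has a coefficient bounded independently of \<nu>.\<close>
  define P' where "P' z = (z\<^sup>2 / 4 - 1 / 2) * parabolic_cylinder_D (of_real \<nu>) z * exp (- \<i> * of_real \<omega> * z)" for z
  have \<omega>c: "of_real \<omega> * of_real \<omega> = complex_of_real \<nu>" using \<omega> by (simp add: power2_eq_square flip: of_real_mult)
  have Pd: "(P has_field_derivative P' z) (at z)" for z
  proof -
    let ?D = "parabolic_cylinder_D (of_real \<nu>) z" and ?D' = "parabolic_cylinder_D' (of_real \<nu>) z"
    let ?E = "exp (- \<i> * of_real \<omega> * z)"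
    have "(P has_field_derivative
       (((z\<^sup>2 / 4 - of_real \<nu> - 1 / 2) * ?D + \<i> * of_real \<omega> * ?D') * ?E
         + (- \<i> * of_real \<omega> * ?E) * (?D' + \<i> * of_real \<omega> * ?D))) (at z)"
      unfolding P_def
      by (intro DERIV_mult DERIV_add parabolic_cylinder_D'_deriv DERIV_cmult parabolic_cylinder_D_deriv)
         (auto intro!: derivative_eq_intros)
    also have "((z\<^sup>2 / 4 - of_real \<nu> - 1 / 2) * ?D + \<i> * of_real \<omega> * ?D') * ?E
         + (- \<i> * of_real \<omega> * ?E) * (?D' + \<i> * of_real \<omega> * ?D) = P' z"
    proof -
      have alg: "((q - n - h) * d + j * w * d') * e + (- j * w * e) * (d' + j * w * d) = (q - n - h - j * j * (w * w)) * d * e"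
        for q n h d d' e j w :: complex by (simp add: algebra_simps)
      show ?thesis unfolding alg \<omega>c P'_def by simp
    qed
    finally show ?thesis .
  qed
  have "continuous_on S P" using Pd by (auto intro!: continuous_at_imp_continuous_on DERIV_isCont)
  then have "continuous_on S (\<lambda>z. norm (P z))" by (intro continuous_intros)
  then obtain z0 where z0: "z0 \<in> S" "\<And>z. z \<in> S \<Longrightarrow> norm (P z) \<le> norm (P z0)"
    using continuous_attains_sup[OF compact, of "\<lambda>z. norm (P z)"] S by blast
  \<comment> \<open>Bootstrap: the derivative is bounded through the maximum \<open>M\<close>
    itself, whence M \<le> |P 0| + M / 2 by \<open>small\<close>, that is, M \<le> 2 |P 0|.\<close>
  define M where "M = norm (P z0)"
  have P'b: "norm (P' z) \<le> K / \<omega> * M" if zS: "z \<in> S" for z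
  proof -
    obtain t where t: "z = of_real t" "\<bar>t\<bar> \<le> Z" using zS by (auto simp: S_def abs_le_iff)
    obtain d d' where d: "parabolic_cylinder_D (of_real \<nu>) z = of_real d" "parabolic_cylinder_D' (of_real \<nu>) z = of_real d'"
      using parabolic_cylinder_D_in_Reals[of \<nu> t] parabolic_cylinder_D'_in_Reals[of \<nu> t] unfolding t(1) by (auto elim!: Reals_cases)
    have E: "norm (exp (- \<i> * of_real \<omega> * z)) = 1" by (simp add: t(1))
    \<comment> \<open>Since D and D' are real on the segment and the rotation is unimodular,
      \<omega> D is the imaginary part of a number of modulus |P z|. This gains the factor 1 /
      \<omega>.\<close>
    have "norm (P z) = norm (Complex d' (\<omega> * d))"
      unfolding P_def norm_mult E d by (simp add: complex_eq_iff) (simp add: Complex_eq mult.assoc)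
    then have D: "\<omega> * \<bar>d\<bar> \<le> norm (P z)"
      using abs_Im_le_cmod[of "Complex d' (\<omega> * d)"] \<omega> by (simp add: abs_mult)
    have "t\<^sup>2 \<le> Z\<^sup>2" using t(2) Z by (simp add: power2_le_iff_abs_le)
    then have "\<bar>t\<^sup>2 / 4 - 1 / 2\<bar> \<le> K" unfolding K_def abs_le_iff using zero_le_power2[of t] by linarith
    moreover have "norm (z\<^sup>2 / 4 - 1 / 2) = \<bar>t\<^sup>2 / 4 - 1 / 2\<bar>"
      by (simp add: t(1) flip: norm_of_real[where 'a = complex])
    ultimately have "norm (P' z) \<le> K * \<bar>d\<bar>"
      unfolding P'_def norm_mult E d by (simp add: mult_right_mono)
    also have "\<dots> \<le> K * (M / \<omega>)"
      using D z0(2)[OF zS] \<omega> K by (intro mult_left_mono) (auto simp: M_def field_simps)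
    finally show ?thesis by simp
  qed
  have b: "norm (P z - P 0) \<le> Z * K / \<omega> * M" if "z \<in> S" for z
  proof -
    have "norm (P z - P 0) \<le> K / \<omega> * M * norm (z - 0)"
      by (rule field_differentiable_bound[OF convex _ P'b that S(2)]) (use Pd in \<open>auto intro: has_field_derivative_at_within\<close>)
    also have "\<dots> \<le> K / \<omega> * M * Z" using that K \<omega> by (intro mult_left_mono) (auto simp: S_def M_def)
    finally show ?thesis by (simp add: mult_ac)
  qed
  have "Z * K / \<omega> \<le> 1 / 2" using small \<omega> by (simp add: field_simps)
  then have "Z * K / \<omega> * M \<le> 1 / 2 * M" by (intro mult_right_mono) (auto simp: M_def)
  moreover have "M \<le> norm (P 0) + norm (P z0 - P 0)" unfolding M_def using norm_triangle_sub by blast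
  ultimately have M2: "M \<le> 2 * norm (P 0)" using b[OF z0(1)] by linarith
  have "Z * K / \<omega> * M \<le> Z * K / \<omega> * (2 * norm (P 0))" using M2 Z K \<omega> by (intro mult_left_mono) auto
  also have "\<dots> = 2 * (Z * K) / \<omega> * norm (P 0)" by simp
  finally show ?thesis using b[OF S(1)] by linarith
qed

text \<open>This is the coefficient of cos (\<pi> \<nu> / 2) in sqrt \<nu> times the value of D at
  0.\<close>

definition pc_amplitude :: "real \<Rightarrow> real" where
  "pc_amplitude \<nu> = 2 powr (\<nu> / 2) / sqrt pi * Gamma ((\<nu> + 1) / 2) * sqrt \<nu>"

lemma pc_amplitude_pos: "\<nu> > 0 \<Longrightarrow> pc_amplitude \<nu> > 0"
  by (simp add: pc_amplitude_def Gamma_real_pos)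

text \<open>For large \<nu>, D behaves like a multiple of cos \<alpha> and D' like the same multiple
  of sqrt \<nu> sin \<alpha>, where \<alpha> = \<pi> \<nu> / 2 - sqrt \<nu> x. Dividing by the
  amplitude and rotating by \<alpha> makes the vector converge, because (sin \<alpha> + \<i> cos
  \<alpha>) exp (\<i> \<alpha>) = \<i>.\<close>

definition pc_phase :: "real \<Rightarrow> real \<Rightarrow> complex" where
  "pc_phase x \<nu> = (parabolic_cylinder_D' (of_real \<nu>) (of_real x) + \<i> * of_real (sqrt \<nu>) * parabolic_cylinder_D (of_real \<nu>) (of_real x))
      / of_real (pc_amplitude \<nu>) * exp (\<i> * of_real (pi * \<nu> / 2 - sqrt \<nu> * x))"

text \<open>At x = 0 the normalised vector is exactly \<rho> sin a + \<i> cos a. Were \<rho> equal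
  to 1, its rotation would be \<i>; the error is (\<rho> - 1) sin a in modulus.\<close>

lemma pc_phase_0:
  assumes "\<nu> > 0"
  shows "norm (pc_phase 0 \<nu> - \<i>) \<le> 1 / \<nu>"
proof -
  define \<rho> where "\<rho> = sqrt 2 * Gamma (\<nu> / 2 + 1) / (sqrt \<nu> * Gamma ((\<nu> + 1) / 2))"
  define a where "a = pi * \<nu> / 2"
  define c where "c = 2 powr (\<nu> / 2) / sqrt pi"
  define g where "g = Gamma ((\<nu> + 1) / 2)"
  have g: "g > 0" unfolding g_def using assms by (intro Gamma_real_pos) simp
  have c: "c > 0" by (simp add: c_def)
  have D: "parabolic_cylinder_D (of_real \<nu>) 0 = of_real (c * cos a * g)"
    using parabolic_cylinder_D_zero_real[OF assms] by (simp add: c_def a_def g_def)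
  have \<rho>: "sqrt 2 * Gamma (\<nu> / 2 + 1) = \<rho> * (sqrt \<nu> * g)"
    unfolding \<rho>_def g_def [symmetric] using g assms by simp
  have p: "2 powr ((\<nu> + 1) / 2) = 2 powr (\<nu> / 2) * sqrt 2"
    by (simp add: add_divide_distrib powr_add powr_half_sqrt)
  have "2 powr ((\<nu> + 1) / 2) / sqrt pi * sin (pi * \<nu> / 2) * Gamma (\<nu> / 2 + 1)
      = c * sin a * (sqrt 2 * Gamma (\<nu> / 2 + 1))"
    unfolding p c_def a_def by simp
  also have "\<dots> = c * g * sqrt \<nu> * \<rho> * sin a" unfolding \<rho> by (simp only: mult_ac)
  finally have "2 powr ((\<nu> + 1) / 2) / sqrt pi * sin (pi * \<nu> / 2) * Gamma (\<nu> / 2 + 1) = c * g * sqrt \<nu> * \<rho> * sin a" .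
  then have D': "parabolic_cylinder_D' (of_real \<nu>) 0 = of_real (c * g * sqrt \<nu> * \<rho> * sin a)"
    using parabolic_cylinder_D'_zero_real[OF assms] by simp
  have amp: "pc_amplitude \<nu> = c * g * sqrt \<nu>" by (simp add: pc_amplitude_def c_def g_def)
  have "(parabolic_cylinder_D' (of_real \<nu>) 0 + \<i> * of_real (sqrt \<nu>) * parabolic_cylinder_D (of_real \<nu>) 0)
     = of_real (c * g * sqrt \<nu>) * (of_real (\<rho> * sin a) + \<i> * of_real (cos a))"
    unfolding D D' by (simp add: algebra_simps)
  then have "pc_phase 0 \<nu> = (of_real (\<rho> * sin a) + \<i> * of_real (cos a)) * exp (\<i> * of_real a)"
    unfolding pc_phase_def of_real_0 amp using c g assms by (simp add: a_def)
  also have "\<dots> = of_real (\<rho> - 1) * of_real (sin a) * exp (\<i> * of_real a) + \<i> * (exp (- (\<i> * of_real a)) * exp (\<i> * of_real a))"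
  proof -
    have "exp (- (\<i> * of_real a)) = of_real (cos a) - \<i> * of_real (sin a)"
      using exp_Euler[of "- of_real a"] by (simp add: cos_of_real sin_of_real)
    then have C: "complex_of_real (cos a) = exp (- (\<i> * of_real a)) + \<i> * of_real (sin a)" by simp
    have alg: "(r * s + \<i> * (w + \<i> * s)) * e = (r - 1) * s * e + \<i> * (w * e)" for r s w e :: complex
      by (simp add: algebra_simps)
    show ?thesis unfolding C of_real_mult of_real_diff of_real_1 by (rule alg)
  qed
  also have "exp (- (\<i> * of_real a)) * exp (\<i> * of_real a) = 1" by (simp flip: exp_add)
  finally have "norm (pc_phase 0 \<nu> - \<i>) = \<bar>\<rho> - 1\<bar> * \<bar>sin a\<bar>"
    by (simp add: norm_mult del: of_real_diff)
  also have "\<dots> \<le> \<bar>\<rho> - 1\<bar> * 1" by (intro mult_left_mono) auto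
  also have "\<dots> \<le> 1 / \<nu>" using Gamma_half_step_ratio[OF assms] by (simp add: \<rho>_def)
  finally show ?thesis .
qed

lemma tendsto_pc_phase: "(pc_phase x \<longlongrightarrow> \<i>) at_top"
proof -
  \<comment> \<open>\<open>L\<close> is the product Z * K of the phase bound for Z = |x|; orders
    \<nu> \<ge> (2 L)^2 meet its smallness condition.\<close>
  define L where "L = \<bar>x\<bar> * (\<bar>x\<bar>\<^sup>2 / 4 + 1 / 2)"
  have "((\<lambda>\<nu>. pc_phase x \<nu> - \<i>) \<longlongrightarrow> 0) at_top"
  proof (rule Lim_null_comparison)
    show "\<forall>\<^sub>F \<nu> in at_top. norm (pc_phase x \<nu> - \<i>) \<le> 2 * L / sqrt \<nu> * (1 + 1 / \<nu>) + 1 / \<nu>"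
    proof (rule eventually_at_top_linorderI[of "max 1 ((2 * L)\<^sup>2)"])
      fix \<nu> :: real assume "max 1 ((2 * L)\<^sup>2) \<le> \<nu>"
      then have \<nu>: "\<nu> > 0" "(2 * L)\<^sup>2 \<le> \<nu>" by auto
      then have small: "2 * L \<le> sqrt \<nu>" by (intro real_le_rsqrt)
      define P where "P = (\<lambda>z. (parabolic_cylinder_D' (of_real \<nu>) z + \<i> * of_real (sqrt \<nu>) * parabolic_cylinder_D (of_real \<nu>) z) * exp (- \<i> * of_real (sqrt \<nu>) * z))"
      define e where "e = exp (\<i> * of_real (pi * \<nu> / 2)) / of_real (pc_amplitude \<nu>)"
      have ph: "pc_phase y \<nu> = P (of_real y) * e" for y
      proof -
        have "exp (\<i> * of_real (pi * \<nu> / 2 - sqrt \<nu> * y)) = exp (- \<i> * of_real (sqrt \<nu>) * of_real y) * exp (\<i> * of_real (pi * \<nu> / 2))"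
          unfolding exp_add [symmetric] by (simp add: algebra_simps)
        then show ?thesis by (simp add: pc_phase_def P_def e_def)
      qed
      have "norm (pc_phase x \<nu> - pc_phase 0 \<nu>) = norm (P (of_real x) - P 0) * norm e"
        unfolding ph of_real_0 by (simp flip: norm_mult left_diff_distrib)
      also have "\<dots> \<le> 2 * L / sqrt \<nu> * norm (P 0) * norm e"
        using parabolic_cylinder_phase_bound[OF \<nu>(1) order_refl[of "\<bar>x\<bar>"]] small
        by (intro mult_right_mono) (auto simp: L_def P_def)
      also have "\<dots> = 2 * L / sqrt \<nu> * norm (pc_phase 0 \<nu>)" by (simp add: ph norm_mult)
      also have "\<dots> \<le> 2 * L / sqrt \<nu> * (1 + 1 / \<nu>)"
        using norm_triangle_sub[of "pc_phase 0 \<nu>" \<i>] pc_phase_0[OF \<nu>(1)] \<nu>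
        by (intro mult_left_mono) (auto simp: L_def)
      finally have "norm (pc_phase x \<nu> - pc_phase 0 \<nu>) \<le> 2 * L / sqrt \<nu> * (1 + 1 / \<nu>)" .
      then show "norm (pc_phase x \<nu> - \<i>) \<le> 2 * L / sqrt \<nu> * (1 + 1 / \<nu>) + 1 / \<nu>"
        using norm_triangle_ineq[of "pc_phase x \<nu> - pc_phase 0 \<nu>" "pc_phase 0 \<nu> - \<i>"] pc_phase_0[OF \<nu>(1)] by simp
    qed
    have s: "((\<lambda>\<nu>. 1 / sqrt \<nu>) \<longlongrightarrow> 0) at_top" and i: "((\<lambda>\<nu>::real. 1 / \<nu>) \<longlongrightarrow> 0) at_top"
      by real_asymp+
    have "((\<lambda>\<nu>. 2 * L * (1 / sqrt \<nu>) * (1 + 1 / \<nu>) + 1 / \<nu>) \<longlongrightarrow> 2 * L * 0 * (1 + 0) + 0) at_top"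
      by (intro tendsto_intros s i)
    then show "((\<lambda>\<nu>. 2 * L / sqrt \<nu> * (1 + 1 / \<nu>) + 1 / \<nu>) \<longlongrightarrow> 0) at_top" by simp
  qed
  then show ?thesis by (simp add: LIM_zero_iff)
qed

section \<open>The spectral gap\<close>

lemma char_fun_in_Reals: "char_fun (of_real (- \<mu>)) \<eta> \<beta> \<in> \<real>"
  unfolding char_fun_real
  by (intro Reals_minus Reals_add Reals_mult parabolic_cylinder_D_in_Reals parabolic_cylinder_D'_in_Reals Reals_of_real)

text \<open>The total phase \<open>p\<close> governs the sign: the product of the two rotated vectors tends to \<open>-1\<close>.\<close>

lemma char_fun_phase:
  fixes \<beta> \<eta> \<mu> :: real
  assumes \<eta>: "\<eta> > 0" and \<mu>: "\<mu> > 0"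
  defines "p \<equiv> (\<beta> / \<eta> - \<beta>) * sqrt \<mu> - pi / 2 * (1 + 1 / \<eta>) * \<mu>"
  shows "\<exists>k>0. Re (char_fun (of_real (- \<mu>)) \<eta> \<beta>)
     = - k * Im (pc_phase (- \<beta>) \<mu> * pc_phase (\<beta> / sqrt \<eta>) (\<mu> / \<eta>) * exp (\<i> * of_real p))"
proof -
  define b where "b = \<beta> / sqrt \<eta>"
  define \<nu> where "\<nu> = \<mu> / \<eta>"
  have \<nu>: "\<nu> > 0" using \<eta> \<mu> by (simp add: \<nu>_def)
  obtain A A' B B' where r: "parabolic_cylinder_D (of_real \<mu>) (of_real (- \<beta>)) = of_real A"
    "parabolic_cylinder_D' (of_real \<mu>) (of_real (- \<beta>)) = of_real A'"
    "parabolic_cylinder_D (of_real \<nu>) (of_real b) = of_real B"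
    "parabolic_cylinder_D' (of_real \<nu>) (of_real b) = of_real B'"
    using parabolic_cylinder_D_in_Reals[of \<mu> "- \<beta>"] parabolic_cylinder_D'_in_Reals[of \<mu> "- \<beta>"]
      parabolic_cylinder_D_in_Reals[of \<nu> b] parabolic_cylinder_D'_in_Reals[of \<nu> b]
    by (auto elim!: Reals_cases)
  define c where "c = pc_amplitude \<mu> * pc_amplitude \<nu>"
  have c: "c > 0" unfolding c_def using pc_amplitude_pos[OF \<mu>] pc_amplitude_pos[OF \<nu>] by simp
  \<comment> \<open>By its definition \<open>p\<close> is minus the sum of the two phase angles,
    since sqrt \<nu> * b = (\<beta> / \<eta>) * sqrt \<mu>.\<close>
  have ex: "exp (\<i> * of_real (pi * \<mu> / 2 - sqrt \<mu> * - \<beta>)) * exp (\<i> * of_real (pi * \<nu> / 2 - sqrt \<nu> * b)) * exp (\<i> * of_real p) = 1"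
  proof -
    have "sqrt \<nu> * b = \<beta> / \<eta> * sqrt \<mu>"
      using \<eta> by (simp add: \<nu>_def b_def real_sqrt_divide)
    then have "(pi * \<mu> / 2 - sqrt \<mu> * - \<beta>) + (pi * \<nu> / 2 - sqrt \<nu> * b) + p = 0"
      by (simp add: p_def \<nu>_def algebra_simps)
    then have "\<i> * of_real (pi * \<mu> / 2 - sqrt \<mu> * - \<beta>) + \<i> * of_real (pi * \<nu> / 2 - sqrt \<nu> * b) + \<i> * of_real p = 0"
      by (metis distrib_left mult_zero_right of_real_0 of_real_add)
    then show ?thesis by (simp only: exp_add [symmetric] exp_zero)
  qed
  define X where "X = Complex A' (sqrt \<mu> * A)"
  define Y where "Y = Complex B' (sqrt \<nu> * B)"
  have X: "pc_phase (- \<beta>) \<mu> = X / of_real (pc_amplitude \<mu>) * exp (\<i> * of_real (pi * \<mu> / 2 - sqrt \<mu> * - \<beta>))"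
    unfolding pc_phase_def r X_def by (simp add: Complex_eq mult.assoc)
  have Y: "pc_phase b \<nu> = Y / of_real (pc_amplitude \<nu>) * exp (\<i> * of_real (pi * \<nu> / 2 - sqrt \<nu> * b))"
    unfolding pc_phase_def r Y_def by (simp add: Complex_eq mult.assoc)
  have "pc_phase (- \<beta>) \<mu> * pc_phase b \<nu> * exp (\<i> * of_real p) = X * Y / of_real c *
     (exp (\<i> * of_real (pi * \<mu> / 2 - sqrt \<mu> * - \<beta>)) * exp (\<i> * of_real (pi * \<nu> / 2 - sqrt \<nu> * b)) * exp (\<i> * of_real p))"
    unfolding X Y c_def by (simp only: of_real_mult divide_inverse inverse_mult_distrib mult_ac)
  also have "\<dots> = X * Y / of_real c" unfolding ex by simp
  finally have "Im (pc_phase (- \<beta>) \<mu> * pc_phase b \<nu> * exp (\<i> * of_real p)) = Im (X * Y) / c" by simp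
  \<comment> \<open>Multiplying the two vectors adds their phases, and the imaginary part of the
    product is the Wronskian at the interface because sqrt \<mu> = sqrt \<nu> * sqrt \<eta>.\<close>
  also have "Im (X * Y) = sqrt \<nu> * (sqrt \<eta> * A * B' + A' * B)"
  proof -
    have "sqrt \<mu> = sqrt \<nu> * sqrt \<eta>" using \<eta> by (simp add: \<nu>_def real_sqrt_divide)
    then show ?thesis by (simp add: X_def Y_def algebra_simps)
  qed
  also have "sqrt \<eta> * A * B' + A' * B = - Re (char_fun (of_real (- \<mu>)) \<eta> \<beta>)"
    unfolding char_fun_real \<nu>_def [symmetric] b_def [symmetric] r by simp
  finally have "Im (pc_phase (- \<beta>) \<mu> * pc_phase b \<nu> * exp (\<i> * of_real p))
     = sqrt \<nu> * - Re (char_fun (of_real (- \<mu>)) \<eta> \<beta>) / c" .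
  then have "Re (char_fun (of_real (- \<mu>)) \<eta> \<beta>) = - (c / sqrt \<nu>) * Im (pc_phase (- \<beta>) \<mu> * pc_phase b \<nu> * exp (\<i> * of_real p))"
    using c \<nu> by simp
  moreover have "c / sqrt \<nu> > 0" using c \<nu> by simp
  ultimately show ?thesis unfolding \<nu>_def b_def by blast
qed

section \<open>Sign changes and the largest negative zero\<close>

lemma linear_minus_sqrt_attains:
  fixes k m L y :: real
  assumes m: "m > 0" and L: "L > 0" and y: "y \<le> k * sqrt L - m * L"
  shows "\<exists>x\<ge>L. k * sqrt x - m * x = y"
proof -
  \<comment> \<open>From a completed square, k sqrt U \<le> (m / 2) U + k^2 / (2 m). The second
    entry of the maximum is where k^2 / (2 m) - (m / 2) U falls to \<open>y\<close>.\<close>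
  define U where "U = max L ((k\<^sup>2 / (2 * m) - y) / (m / 2))"
  have U: "U \<ge> L" "U > 0" using L by (auto simp: U_def)
  have "0 \<le> m / 2 * (sqrt U - k / m)\<^sup>2" using m by simp
  also have "\<dots> = m / 2 * U - k * sqrt U + k\<^sup>2 / (2 * m)"
    using m U by (simp add: power2_diff field_simps power2_eq_square)
  finally have "k * sqrt U - m * U \<le> k\<^sup>2 / (2 * m) - m / 2 * U" by simp
  also have "\<dots> \<le> y"
  proof -
    have "(k\<^sup>2 / (2 * m) - y) / (m / 2) \<le> U" by (simp add: U_def)
    then show ?thesis using m by (simp add: pos_divide_le_eq algebra_simps)
  qed
  finally have "k * sqrt U - m * U \<le> y" .
  moreover have "continuous_on {L..U} (\<lambda>x. k * sqrt x - m * x)" by (intro continuous_intros)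
  ultimately show ?thesis using IVT2'[of "\<lambda>x. k * sqrt x - m * x" U y L] y U by auto
qed

text \<open>Where the total phase is -\<pi> / 2 or -3 \<pi> / 2 modulo full turns, the rotation is
  -\<i> or \<i>. As \<open>R\<close> tends to -1, the two imaginary parts have opposite signs there.
  Both phases occur at arbitrarily large \<mu>, because the linear term of the phase outgrows the
  square root.\<close>

lemma char_fun_sign_changes:
  assumes \<eta>: "\<eta> > 0"
  obtains \<mu>1 \<mu>2 where "\<mu>1 > 0" "\<mu>2 > 0"
    "Re (char_fun (of_real (- \<mu>1)) \<eta> \<beta>) < 0" "Re (char_fun (of_real (- \<mu>2)) \<eta> \<beta>) > 0"
proof -
  define k where "k = \<beta> / \<eta> - \<beta>"
  define m where "m = pi / 2 * (1 + 1 / \<eta>)"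
  define R where "R \<mu> = pc_phase (- \<beta>) \<mu> * pc_phase (\<beta> / sqrt \<eta>) (\<mu> / \<eta>)" for \<mu>
  have m: "m > 0" using \<eta> by (simp add: m_def add_pos_pos)
  have "filterlim (\<lambda>\<mu>. \<mu> / \<eta>) at_top at_top" using \<eta> by real_asymp
  then have "((\<lambda>\<mu>. pc_phase (\<beta> / sqrt \<eta>) (\<mu> / \<eta>)) \<longlongrightarrow> \<i>) at_top"
    by (rule filterlim_compose[OF tendsto_pc_phase])
  then have "(R \<longlongrightarrow> \<i> * \<i>) at_top" unfolding R_def [abs_def] by (intro tendsto_mult tendsto_pc_phase)
  then have "eventually (\<lambda>\<mu>. dist (R \<mu>) (\<i> * \<i>) < 1) at_top" by (rule tendstoD) simp
  then obtain L0 where L0: "\<And>\<mu>. \<mu> \<ge> L0 \<Longrightarrow> dist (R \<mu>) (\<i> * \<i>) < 1" by (auto simp: eventually_at_top_linorder)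
  define L where "L = max 1 L0"
  have L: "L > 0" by (simp add: L_def)
  have R: "Re (R \<mu>) < 0" if "\<mu> \<ge> L" for \<mu>
    using L0[of \<mu>] that abs_Re_le_cmod[of "R \<mu> + 1"] by (auto simp: L_def dist_norm)
  \<comment> \<open>Enough full turns to put both target phases below the phase at \<open>L\<close>,
    so that they are attained beyond \<open>L\<close>.\<close>
  obtain n :: nat where n: "- (k * sqrt L - m * L) \<le> real n" using real_arch_simple by blast
  have n': "- (2 * pi * real n) \<le> k * sqrt L - m * L" 
  proof -
    have "real n * 1 \<le> real n * (2 * pi)" using pi_gt3 by (intro mult_left_mono) auto
    then show ?thesis using n by (simp add: mult_ac)
  qed
  obtain \<mu>1 where \<mu>1: "\<mu>1 \<ge> L" "k * sqrt \<mu>1 - m * \<mu>1 = - (2 * pi * real n) - pi / 2"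
    using linear_minus_sqrt_attains[OF m L, of "- (2 * pi * real n) - pi / 2" k] n' pi_gt_zero by fastforce
  obtain \<mu>2 where \<mu>2: "\<mu>2 \<ge> L" "k * sqrt \<mu>2 - m * \<mu>2 = - (2 * pi * real n) - 3 * pi / 2"
    using linear_minus_sqrt_attains[OF m L, of "- (2 * pi * real n) - 3 * pi / 2" k] n' pi_gt_zero by fastforce
  have cs: "cos (- (2 * pi * real n) - a) = cos a" "sin (- (2 * pi * real n) - a) = - sin a" for a
    using cos_2npi[of n] sin_2npi[of n] by (simp_all add: cos_diff sin_diff mult_ac)
  have e1: "exp (\<i> * of_real (k * sqrt \<mu>1 - m * \<mu>1)) = - \<i>"
    unfolding \<mu>1(2) exp_Euler cos_of_real sin_of_real cs by simp
  have e2: "exp (\<i> * of_real (k * sqrt \<mu>2 - m * \<mu>2)) = \<i>"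
    using cos_3over2_pi sin_3over2_pi unfolding \<mu>2(2) exp_Euler cos_of_real sin_of_real cs by simp
  obtain k1 where k1: "k1 > 0" "Re (char_fun (of_real (- \<mu>1)) \<eta> \<beta>) = - k1 * Im (R \<mu>1 * - \<i>)"
    using char_fun_phase[OF \<eta>, of \<mu>1 \<beta>] \<mu>1(1) L e1 unfolding k_def m_def R_def by auto
  obtain k2 where k2: "k2 > 0" "Re (char_fun (of_real (- \<mu>2)) \<eta> \<beta>) = - k2 * Im (R \<mu>2 * \<i>)"
    using char_fun_phase[OF \<eta>, of \<mu>2 \<beta>] \<mu>2(1) L e2 unfolding k_def m_def R_def by auto
  show thesis
  proof (rule that)
    show "\<mu>1 > 0" "\<mu>2 > 0" using \<mu>1 \<mu>2 L by auto
    show "Re (char_fun (of_real (- \<mu>1)) \<eta> \<beta>) < 0" unfolding k1(2) using k1(1) R[OF \<mu>1(1)] by (simp add: mult_pos_neg)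
    show "Re (char_fun (of_real (- \<mu>2)) \<eta> \<beta>) > 0" unfolding k2(2) using k2(1) R[OF \<mu>2(1)] by (simp add: mult_pos_neg)
  qed
qed

lemma holomorphic_char_fun: "\<eta> > 0 \<Longrightarrow> (\<lambda>\<theta>. char_fun \<theta> \<eta> \<beta>) holomorphic_on A"
  unfolding char_fun_def by (intro holomorphic_intros) auto

lemma char_fun_has_negative_zero:
  assumes \<eta>: "\<eta> > 0"
  obtains \<theta> :: real where "\<theta> < 0" "char_fun (of_real \<theta>) \<eta> \<beta> = 0"
proof -
  obtain \<mu>1 \<mu>2 where \<mu>: "\<mu>1 > 0" "\<mu>2 > 0"
    "Re (char_fun (of_real (- \<mu>1)) \<eta> \<beta>) < 0" "Re (char_fun (of_real (- \<mu>2)) \<eta> \<beta>) > 0"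
    by (rule char_fun_sign_changes[OF \<eta>])
  define g where "g \<mu> = Re (char_fun (of_real (- \<mu>)) \<eta> \<beta>)" for \<mu> :: real
  have cc: "continuous_on UNIV (\<lambda>\<theta>. char_fun \<theta> \<eta> \<beta>)"
    by (rule holomorphic_on_imp_continuous_on[OF holomorphic_char_fun[OF \<eta>]])
  have "continuous_on UNIV g" unfolding g_def [abs_def]
    by (intro continuous_on_Re continuous_on_compose2[OF cc] continuous_intros) auto
  then have "connected (g ` {0<..})"
    by (intro connected_continuous_image) (auto intro: continuous_on_subset)
  then have "0 \<in> g ` {0<..}"
    using connectedD_interval[of "g ` {0<..}" "g \<mu>1" "g \<mu>2" 0] \<mu> by (auto simp: g_def)
  then obtain \<mu> where m: "\<mu> > 0" "g \<mu> = 0" by auto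
  have "char_fun (of_real (- \<mu>)) \<eta> \<beta> = 0"
    using m(2) char_fun_in_Reals[of \<mu> \<eta> \<beta>] by (auto simp: g_def complex_is_Real_iff complex_eq_iff)
  then show thesis using that[of "- \<mu>"] m(1) by simp
qed

text \<open>One negative zero \<theta>0 reduces the search to the interval from \<theta>0 to 0. Its
  closure lies in a closed disc where a nonconstant entire function has finitely many zeros, so the
  negative zeros cannot approach 0 and a maximum exists.\<close>

lemma char_fun_largest_negative_zero:
  assumes \<eta>: "\<eta> > 0"
  obtains \<theta>h :: real where "\<theta>h < 0" "char_fun (of_real \<theta>h) \<eta> \<beta> = 0"
    "\<And>\<theta>::real. \<theta> < 0 \<Longrightarrow> char_fun (of_real \<theta>) \<eta> \<beta> = 0 \<Longrightarrow> \<theta> \<le> \<theta>h"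
proof -
  obtain \<theta>0 :: real where \<theta>0: "\<theta>0 < 0" "char_fun (of_real \<theta>0) \<eta> \<beta> = 0"
    by (rule char_fun_has_negative_zero[OF \<eta>])
  obtain \<mu>1 \<mu>2 :: real where \<mu>: "Re (char_fun (of_real (- \<mu>1)) \<eta> \<beta>) < 0"
    by (rule char_fun_sign_changes[OF \<eta>])
  \<comment> \<open>A zero at \<theta>0 and a value with negative real part at -\<mu>1 rule out a
    constant function.\<close>
  have "\<not> (\<lambda>\<theta>. char_fun \<theta> \<eta> \<beta>) constant_on UNIV"
    using \<mu> \<theta>0(2) unfolding constant_on_def by (metis UNIV_I less_irrefl zero_complex.sel(1))
  then have fin: "finite {z \<in> cball 0 \<bar>\<theta>0\<bar>. char_fun z \<eta> \<beta> = 0}"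
    by (intro holomorphic_compact_finite_zeros[where S = UNIV] holomorphic_char_fun \<eta>) auto
  define T where "T = {\<theta>::real. \<theta>0 \<le> \<theta> \<and> \<theta> < 0 \<and> char_fun (of_real \<theta>) \<eta> \<beta> = 0}"
  have "finite (complex_of_real ` T)"
    by (rule finite_subset[OF _ fin]) (auto simp: T_def)
  then have T: "finite T" by (rule finite_imageD) (auto simp: inj_on_def)
  have T0: "\<theta>0 \<in> T" using \<theta>0 by (simp add: T_def)
  then have M: "Max T \<in> T" using T by (intro Max_in) auto
  show thesis
  proof (rule that)
    show "Max T < 0" "char_fun (of_real (Max T)) \<eta> \<beta> = 0" using M by (auto simp: T_def)
    fix \<theta> :: real assume t: "\<theta> < 0" "char_fun (of_real \<theta>) \<eta> \<beta> = 0"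
    show "\<theta> \<le> Max T"
    proof (cases "\<theta>0 \<le> \<theta>")
      case True
      then show ?thesis using t T by (intro Max_ge) (auto simp: T_def)
    next
      case False
      then show ?thesis using Max_ge[OF T T0] by simp
    qed
  qed
qed

theorem theorem1:
  fixes \<beta> \<eta> :: real
  assumes "\<eta> > 0"
  shows "(\<exists>r \<theta>h :: real.
            is_spectral_gap \<beta> \<eta> r \<and> r = - \<theta>h \<and>
            \<theta>h < 0 \<and> char_fun (of_real \<theta>h) \<eta> \<beta> = 0 \<and>
            (\<forall>\<theta>::real. \<theta> < 0 \<longrightarrow> char_fun (of_real \<theta>) \<eta> \<beta> = 0 \<longrightarrow> \<theta> \<le> \<theta>h)) \<and>
         (\<beta> = 0 \<longrightarrow>
           (\<forall>\<theta>::complex.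
              char_fun \<theta> \<eta> \<beta> = 0 \<longleftrightarrow>
              of_real (sqrt \<eta>) * rGamma (\<theta> / (2 * of_real \<eta>)) * rGamma ((1 + \<theta>) / 2)
                + rGamma (\<theta> / 2) * rGamma (1 / 2 + \<theta> / (2 * of_real \<eta>)) = 0))"
proof -
  obtain \<theta>h :: real where \<theta>h: "\<theta>h < 0" "char_fun (of_real \<theta>h) \<eta> \<beta> = 0"
    and max: "\<And>\<theta>::real. \<theta> < 0 \<Longrightarrow> char_fun (of_real \<theta>) \<eta> \<beta> = 0 \<Longrightarrow> \<theta> \<le> \<theta>h"
    using char_fun_largest_negative_zero[OF assms] by metis
  \<comment> \<open>Negation exchanges negative real zeros and positive eigenvalues and reverses the
    order, so the largest zero becomes the smallest positive eigenvalue.\<close>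
  have "is_spectral_gap \<beta> \<eta> (- \<theta>h)"
    unfolding is_spectral_gap_def spectrum_iff_char_fun[OF assms]
  proof (intro conjI ballI impI)
    show "char_fun (of_real (- (- \<theta>h))) \<eta> \<beta> = 0" using \<theta>h by simp
    fix \<mu> assume "\<mu> \<in> spectrum \<beta> \<eta>" "\<mu> > 0"
    then have "- \<mu> \<le> \<theta>h" by (intro max) (simp_all add: spectrum_iff_char_fun[OF assms] del: of_real_minus)
    then show "- \<theta>h \<le> \<mu>" by simp
  qed (use \<theta>h in simp)
  then show ?thesis
    using \<theta>h max char_fun_zero_drift_iff[OF assms] by auto
qed

end
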